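(* Let $\alpha>0$, let $u,v,\varphi\in H(\mathbb{D})$ with $\varphi(\mathbb{D})\subseteq\mathbb{D}$. Then the following are equivalent: (i) the operator $T_{u,v,\varphi}:B_1\to\mathcal{Z}_\alpha$ is bounded; (ii) for each $j\in\{1,\dots,4\}$, $\sup_{a\in\mathbb{D}}\|T_{u,v,\varphi}f_{j,a}\|_{\mathcal{Z}_\alpha}<\infty$, and $$\sup_{z\in\mathbb{D}}(1-|z|^2)^\alpha\big(|u''(z)|+|(2u'\varphi'+u\varphi''+v'')(z)|\big)<\infty,$$ $$\sup_{z\in\mathbb{D}}(1-|z|^2)^\alpha\big(|(u(\varphi')^2+2v'\varphi'+v\varphi'')(z)|+|(v(\varphi')^2)(z)|\big)<\infty;$$ (iii) $$\sup_{z\in\mathbb{D}}(1-|z|^2)^\alpha\Big(|u''(z)|+\frac{|(2u'\varphi'+u\varphi''+v'')(z)|}{1-|\varphi(z)|^2}\Big)<\infty,$$ $$\sup_{z\in\mathbb{D}}(1-|z|^2)^\alpha\Big(\frac{|(u(\varphi')^2+2v'\varphi'+v\varphi'')(z)|}{(1-|\varphi(z)|^2)^2}+\frac{|(v(\varphi')^2)(z)|}{(1-|\varphi(z)|^2)^3}\Big)<\infty.$$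
   Context: $\mathbb{D}$ is the open unit disc and $H(\mathbb{D})$ the space of analytic functions on $\mathbb{D}$. For $\alpha>0$, $\mathcal{Z}_\alpha$ consists of $f\in H(\mathbb{D})$ with $\sup_{z}(1-|z|^2)^\alpha|f''(z)|<\infty$, with norm $\|f\|_{\mathcal{Z}_\alpha}=|f(0)|+|f'(0)|+\sup_{z}(1-|z|^2)^\alpha|f''(z)|$. $B_1$ (minimal Möbius invariant space) is the space of $f=\sum_k c_k\sigma_{a_k}$, $a_k\in\mathbb{D}$, $\sum|c_k|<\infty$, $\sigma_a(z)=\frac{a-z}{1-\bar az}$, with norm the infimum of $\sum|c_k|$; equivalently $f\in H(\mathbb{D})$ with $f''\in L^1(\mathbb{D},dA)$, norm comparable to $|f(0)|+|f'(0)|+\int_{\mathbb{D}}|f''|dA$. The Stević–Sharma operator is $T_{u,v,\varphi}f(z)=u(z)f(\varphi(z))+v(z)f'(\varphi(z))$. For $j\in\mathbb{N}$, $a\in\mathbb{D}$: $f_{j,a}(z)=\left(\frac{1-|a|^2}{1-\bar az}\right)^j$. *)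

theory Defs
  imports "HOL-Analysis.Analysis"
begin

abbreviation disc :: "complex set" where "disc \<equiv> ball 0 1"

abbreviation deriv2 :: "(complex \<Rightarrow> complex) \<Rightarrow> complex \<Rightarrow> complex" where
  "deriv2 f \<equiv> deriv (deriv f)"

definition in_Zalpha :: "real \<Rightarrow> (complex \<Rightarrow> complex) \<Rightarrow> bool" where
  "in_Zalpha \<alpha> f \<longleftrightarrow> f holomorphic_on disc \<and>
     bdd_above ((\<lambda>z. (1 - (cmod z)\<^sup>2) powr \<alpha> * cmod (deriv2 f z)) ` disc)"

definition Zalpha_norm :: "real \<Rightarrow> (complex \<Rightarrow> complex) \<Rightarrow> real" where
  "Zalpha_norm \<alpha> f = cmod (f 0) + cmod (deriv f 0) +
     (SUP z\<in>disc. (1 - (cmod z)\<^sup>2) powr \<alpha> * cmod (deriv2 f z))"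

text \<open>Minimal Moebius invariant space B_1, via the equivalent characterisation f'' in L^1(dA),
  dA the normalised area measure (Lebesgue measure on the plane divided by pi).\<close>
definition in_B1 :: "(complex \<Rightarrow> complex) \<Rightarrow> bool" where
  "in_B1 f \<longleftrightarrow> f holomorphic_on disc \<and>
     set_integrable lborel disc (\<lambda>z. cmod (deriv2 f z))"

definition B1_norm :: "(complex \<Rightarrow> complex) \<Rightarrow> real" where
  "B1_norm f = cmod (f 0) + cmod (deriv f 0) +
     (LINT z:disc|lborel. cmod (deriv2 f z)) / pi"

definition T_op :: "(complex \<Rightarrow> complex) \<Rightarrow> (complex \<Rightarrow> complex) \<Rightarrow> (complex \<Rightarrow> complex)
    \<Rightarrow> (complex \<Rightarrow> complex) \<Rightarrow> complex \<Rightarrow> complex" where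
  "T_op u v \<phi> f = (\<lambda>z. u z * f (\<phi> z) + v z * deriv f (\<phi> z))"

definition test_fun :: "nat \<Rightarrow> complex \<Rightarrow> complex \<Rightarrow> complex" where
  "test_fun j a = (\<lambda>z. ((1 - complex_of_real ((cmod a)\<^sup>2)) / (1 - cnj a * z)) ^ j)"

definition bounded_B1_Zalpha :: "real \<Rightarrow> ((complex \<Rightarrow> complex) \<Rightarrow> (complex \<Rightarrow> complex)) \<Rightarrow> bool" where
  "bounded_B1_Zalpha \<alpha> T \<longleftrightarrow>
     (\<exists>C. \<forall>f. in_B1 f \<longrightarrow> in_Zalpha \<alpha> (T f) \<and> Zalpha_norm \<alpha> (T f) \<le> C * B1_norm f)"

end

theory Submission
  imports Defs "HOL-Complex_Analysis.Complex_Analysis"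
begin

unbundle no fps_syntax

text \<open>
  For an analytic \<open>f\<close>, integrating \<open>f''\<close> over the square with corners \<open>0, z, iz, (1 + i)z\<close> bounds
  the mixed difference \<open>f((1 + i)z) - f(z) - f(iz) + f(0)\<close> by \<open>\<integral>|f''|\<close>. Applied to third derivatives, this
  controls \<open>f\<close> on the disc of radius \<open>1 / sqrt 2\<close>; applied to \<open>f\<close> itself, it then bounds \<open>f\<close> on
  the whole unit disc by its \<open>B_1\<close> norm. Cauchy's inequality gives
  \<open>(1 - |w|^2)^n |f^(n)(w)| \<le> C \<parallel>f\<parallel>\<close>, so (iii) implies (i) by the formula
  \<open>(Tf)'' = A f(\<phi>) + B f'(\<phi>) + C f''(\<phi>) + D f'''(\<phi>)\<close>, where \<open>A, B, C, D\<close> are the four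
  coefficient functions of the statement. The monomials \<open>1, z, z^2, z^3\<close> and the uniform \<open>B_1\<close> bound
  of the test functions give (ii) from (i). Finally, evaluating \<open>(T f_{j,a})''\<close> at \<open>a = \<phi>(z)\<close> for \<open>j = 1, ..., 4\<close>
  yields an invertible linear system for \<open>B q, C q^2, D q^3\<close> with
  \<open>q = cnj \<phi>(z) / (1 - |\<phi>(z)|^2)\<close>, which gives (iii) from (ii): where \<open>|\<phi>(z)|\<close> is small, the unweighted
  bounds suffice.
\<close>

subsection \<open>Rotation invariance of planar Lebesgue measure\<close>

text \<open>Lebesgue measure is determined by its values on boxes, and boxes correspond to boxes.
  The copy \<open>real^2\<close> of the plane is where invariance under orthogonal maps is
  applied.\<close>

lemma distr_lborel_vec2_complex:
  "distr lborel borel (\<lambda>x::real^2. Complex (x$1) (x$2)) = lborel"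
proof (rule lborel_eqI[symmetric])
  have m: "(\<lambda>x::real^2. Complex (x$1) (x$2)) \<in> borel_measurable borel"
    by (intro borel_measurable_continuous_onI) (auto simp: complex_eq_iff Complex_eq intro!: continuous_intros)
  fix l u :: complex
  assume le: "\<And>b. b \<in> Basis \<Longrightarrow> l \<bullet> b \<le> u \<bullet> b"
  let ?l = "(\<chi> i::2. if i = 1 then Re l else Im l)" and ?u = "(\<chi> i::2. if i = 1 then Re u else Im u)"
  have "(\<lambda>x::real^2. Complex (x$1) (x$2)) -` box l u = box ?l ?u"
    by (auto simp: in_box_complex_iff mem_box_cart forall_2)
  moreover have "emeasure lborel (box ?l ?u) = ennreal ((Re u - Re l) * (Im u - Im l))"
  proof -
    have B: "Basis = {axis 1 1, axis 2 1 :: real^2}"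
      by (auto simp: Basis_vec_def UNIV_2)
    have "axis 1 1 \<noteq> (axis 2 1 :: real^2)"
      by (simp add: axis_eq_axis)
    moreover have "Re l \<le> Re u" "Im l \<le> Im u"
      using le[of 1] le[of \<i>] by (simp_all add: Basis_complex_def)
    ultimately show ?thesis
      by (subst emeasure_lborel_box) (auto simp: B inner_axis)
  qed
  ultimately show "emeasure (distr lborel borel (\<lambda>x::real^2. Complex (x$1) (x$2))) (box l u) = (\<Prod>b\<in>Basis. (u - l) \<bullet> b)"
    using m by (simp add: emeasure_distr Basis_complex_def inner_diff_left)
qed auto

lemma lborel_emeasure_Times:
  fixes A :: "real set" and B :: "real set"
  assumes "A \<in> sets borel" "B \<in> sets borel"
  shows "emeasure lborel (A \<times> B) = emeasure lborel A * emeasure lborel B"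
  using assms by (simp add: lborel_prod[symmetric] lborel.emeasure_pair_measure_Times)

text \<open>The product copy of the plane serves a different purpose from \<open>real^2\<close>:
  area integrals over squares become iterated integrals.\<close>

lemma distr_lborel_prod_complex:
  "distr lborel borel (\<lambda>p. Complex (fst p) (snd p)) = lborel"
proof (rule lborel_eqI[symmetric])
  have m: "(\<lambda>p. Complex (fst p) (snd p)) \<in> borel_measurable borel"
    by (intro borel_measurable_continuous_onI) (auto simp: complex_eq_iff Complex_eq intro!: continuous_intros)
  fix l u :: complex
  assume le: "\<And>b. b \<in> Basis \<Longrightarrow> l \<bullet> b \<le> u \<bullet> b"
  have eq: "(\<lambda>p. Complex (fst p) (snd p)) -` box l u = {Re l<..<Re u} \<times> {Im l<..<Im u}"
    by (auto simp: mem_box Basis_complex_def)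
  show "emeasure (distr lborel borel (\<lambda>p. Complex (fst p) (snd p))) (box l u) = (\<Prod>b\<in>Basis. (u - l) \<bullet> b)"
    using le[of 1] le[of \<i>]
    using m by (simp add: emeasure_distr eq lborel_emeasure_Times Basis_complex_def ennreal_mult inner_diff_left)
qed auto

text \<open>The preimage of a box under \<open>T\<close> is its image under the inverse
  \<open>S\<close>, and orthogonal images preserve Lebesgue measure. The detour through
  \<open>lebesgue\<close> is harmless because this preimage is Borel.\<close>

lemma distr_lborel_orthogonal_transformation:
  fixes T :: "real^'n::{finite,wellorder} \<Rightarrow> real^'n::_"
  assumes "orthogonal_transformation T"
  shows "distr lborel borel T = lborel"
proof (rule lborel_eqI[symmetric])
  obtain S where S: "orthogonal_transformation S" "\<And>x. S (T x) = x" "\<And>x. T (S x) = x"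
    by (metis assms orthogonal_transformation_inv orthogonal_transformation_bij bij_inv_eq_iff)
  have m: "T \<in> borel_measurable borel"
    using assms by (simp add: borel_measurable_continuous_onI linear_continuous_on linear_linear orthogonal_transformation_linear)
  fix l u :: "real^'n::{finite,wellorder}"
  assume le: "\<And>b. b \<in> Basis \<Longrightarrow> l \<bullet> b \<le> u \<bullet> b"
  have eq: "T -` box l u = S ` box l u" 
  proof (intro equalityI subsetI)
    fix x assume "x \<in> T -` box l u"
    then show "x \<in> S ` box l u"
      by (intro image_eqI[where x = "T x"]) (simp_all add: S(2))
  next
    fix x assume "x \<in> S ` box l u"
    then show "x \<in> T -` box l u"
      by (auto simp: S(3))
  qed
  have "emeasure lborel (T -` box l u) = emeasure lebesgue (S ` box l u)"
    using measurable_sets_borel[OF m, of "box l u"] by (simp add: eq)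
  also have "\<dots> = emeasure lborel (box l u)"
  proof -
    have "emeasure lebesgue (S ` box l u) = ennreal (measure lebesgue (S ` box l u))"
      using measurable_orthogonal_image[OF S(1) lmeasurable_box] by (simp add: emeasure_eq_measure2)
    also have "\<dots> = ennreal (measure lebesgue (box l u))"
      by (simp only: measure_orthogonal_image[OF S(1) lmeasurable_box])
    also have "\<dots> = emeasure lebesgue (box l u)"
      by (simp add: emeasure_eq_measure2)
    finally show ?thesis by simp
  qed
  finally show "emeasure (distr lborel borel T) (box l u) = (\<Prod>b\<in>Basis. (u - l) \<bullet> b)"
    using m le by (simp add: emeasure_distr)
qed auto

lemma distr_lborel_complex_rotation:
  assumes "cmod c = 1"
  shows "distr lborel borel ((*) c) = lborel"
proof -
  let ?h = "\<lambda>x::real^2. Complex (x$1) (x$2)"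
  let ?T = "\<lambda>x::real^2. vector [Re c * x$1 - Im c * x$2, Im c * x$1 + Re c * x$2] :: real^2"
  have hm: "?h \<in> borel_measurable borel"
    by (intro borel_measurable_continuous_onI) (auto simp: complex_eq_iff Complex_eq intro!: continuous_intros)
  have h: "cmod (?h x) = norm x" for x
    by (simp add: norm_vec_def L2_set_def UNIV_2 cmod_def)
  have hT: "?h (?T x) = c * ?h x" for x
    by (simp add: complex_eq_iff vector_2)
  have lin: "linear ?T"
    by (rule linearI) (auto simp: vec_eq_iff forall_2 vector_2 algebra_simps)
  have T: "orthogonal_transformation ?T"
    unfolding orthogonal_transformation
  proof (intro conjI allI lin)
    fix x show "norm (?T x) = norm x"
      unfolding h[of x, symmetric] h[of "?T x", symmetric] hT by (simp add: norm_mult assms)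
  qed
  have Tm: "?T \<in> borel_measurable borel"
    using lin by (simp add: borel_measurable_continuous_onI linear_continuous_on linear_linear)
  have "distr lborel borel ((*) c) = distr (distr lborel borel ?h) borel ((*) c)"
    by (simp add: distr_lborel_vec2_complex)
  also have "\<dots> = distr lborel borel (\<lambda>x. c * ?h x)"
    using hm by (subst distr_distr) (auto simp: comp_def)
  also have "\<dots> = distr lborel borel (?h \<circ> ?T)"
    by (simp only: comp_def hT)
  also have "\<dots> = distr (distr lborel borel ?T) borel ?h"
    using hm Tm by (subst distr_distr) auto
  also have "\<dots> = lborel"
    by (simp only: distr_lborel_orthogonal_transformation[OF T] distr_lborel_vec2_complex)
  finally show ?thesis .
qed

text \<open>The disc is invariant under multiplication by a unimodular \<open>c\<close>, so its
  indicator passes through the change of variables. This later allows a point, or the parameter of a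
  kernel, to be taken real and nonnegative.\<close>

lemma set_integral_disc_rotation:
  fixes g :: "complex \<Rightarrow> real"
  assumes "continuous_on disc g" "cmod c = 1"
  shows "(LINT z:disc|lborel. g (c * z)) = (LINT z:disc|lborel. g z)"
    and "set_integrable lborel disc (\<lambda>z. g (c * z)) \<longleftrightarrow> set_integrable lborel disc g"
proof -
  let ?F = "\<lambda>z. indicator disc z *\<^sub>R g z"
  have F: "?F \<in> borel_measurable borel"
    using assms(1) by (intro borel_measurable_continuous_on_indicator) auto
  have eq: "?F (c * z) = indicator disc z *\<^sub>R g (c * z)" for z
    using assms(2) by (simp add: indicator_def norm_mult)
  have "integral\<^sup>L (distr lborel borel ((*) c)) ?F = (\<integral>z. ?F (c * z) \<partial>lborel)"
    by (rule integral_distr) (use F in simp_all)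
  then show "(LINT z:disc|lborel. g (c * z)) = (LINT z:disc|lborel. g z)"
    unfolding set_lebesgue_integral_def distr_lborel_complex_rotation[OF assms(2)] eq by simp
  have "integrable (distr lborel borel ((*) c)) ?F \<longleftrightarrow> integrable lborel (\<lambda>z. ?F (c * z))"
    by (rule integrable_distr_eq) (use F in simp_all)
  then show "set_integrable lborel disc (\<lambda>z. g (c * z)) \<longleftrightarrow> set_integrable lborel disc g"
    unfolding set_integrable_def distr_lborel_complex_rotation[OF assms(2)] eq by simp
qed

subsection \<open>Mixed differences of functions in \<open>B_1\<close>\<close>

lemma square_subset_disc:
  assumes "0 \<le> Re z" "Re z \<le> r" "0 \<le> Im z" "Im z \<le> r" "2 * r\<^sup>2 < 1"
  shows "z \<in> disc"
proof -
  have "(Re z)\<^sup>2 \<le> r\<^sup>2" "(Im z)\<^sup>2 \<le> r\<^sup>2"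
    using assms by (simp_all add: power_mono)
  then have "(cmod z)\<^sup>2 < 1\<^sup>2"
    using assms(5) by (simp add: cmod_power2)
  then show ?thesis
    by (simp add: power2_less_imp_less)
qed

lemma deriv_vector_horizontal:
  assumes "f holomorphic_on S" "open S" "Complex s t \<in> S"
  shows "((\<lambda>s. f (Complex s t)) has_vector_derivative deriv f (Complex s t)) (at s within A)"
proof -
  have "((\<lambda>s. Complex s t) has_vector_derivative 1) (at s within A)"
    unfolding Complex_eq by (auto intro!: derivative_eq_intros simp: of_real_def)
  from field_vector_diff_chain_within[OF this has_field_derivative_at_within[OF holomorphic_derivI[OF assms]]]
  show ?thesis by (simp add: comp_def)
qed

lemma deriv_vector_vertical:
  assumes "f holomorphic_on S" "open S" "Complex s t \<in> S"
  shows "((\<lambda>t. f (Complex s t)) has_vector_derivative \<i> * deriv f (Complex s t)) (at t within A)"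
proof -
  have "((\<lambda>t. Complex s t) has_vector_derivative \<i>) (at t within A)"
    unfolding Complex_eq by (auto intro!: derivative_eq_intros simp: of_real_def)
  from field_vector_diff_chain_within[OF this has_field_derivative_at_within[OF holomorphic_derivI[OF assms]]]
  show ?thesis by (simp add: comp_def)
qed

text \<open>Passing to real coordinates makes Fubini and the one-variable fundamental theorem of
  calculus available for area integrals.\<close>

lemma set_integral_cbox_complex:
  fixes g :: "complex \<Rightarrow> real"
  assumes g: "continuous_on (cbox l u) g"
  shows "(LINT z:cbox l u|lborel. g z)
    = integral (cbox (Re l, Im l) (Re u, Im u)) (\<lambda>p. g (Complex (fst p) (snd p)))"
proof -
  let ?S = "cbox (Re l, Im l) (Re u, Im u)" and ?c = "\<lambda>p. Complex (fst p) (snd p)"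
  have contC: "continuous_on A ?c" for A
    by (auto simp: Complex_eq intro!: continuous_intros)
  have cont: "continuous_on ?S (\<lambda>p. g (?c p))"
    by (intro continuous_on_compose2[OF g contC]) (auto simp: in_cbox_complex_iff)
  have "(LINT z:cbox l u|lborel. g z) = (\<integral>z. indicator (cbox l u) z *\<^sub>R g z \<partial>distr lborel borel ?c)"
    by (simp only: distr_lborel_prod_complex set_lebesgue_integral_def)
  also have "\<dots> = (\<integral>p. indicator (cbox l u) (?c p) *\<^sub>R g (?c p) \<partial>lborel)"
  proof (rule integral_distr)
    show "?c \<in> lborel \<rightarrow>\<^sub>M borel"
      using borel_measurable_continuous_onI[OF contC] by simp
    show "(\<lambda>z. indicator (cbox l u) z *\<^sub>R g z) \<in> borel_measurable borel"
      using g by (intro borel_measurable_continuous_on_indicator) auto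
  qed
  also have "\<dots> = (LINT p:?S|lborel. g (?c p))"
    unfolding set_lebesgue_integral_def
    by (intro Bochner_Integration.integral_cong refl) (auto simp: indicator_def in_cbox_complex_iff)
  also have "\<dots> = integral ?S (\<lambda>p. g (?c p))"
    by (intro set_borel_integral_eq_integral(2))
       (unfold set_integrable_def, intro borel_integrable_compact cont compact_cbox)
  finally show ?thesis .
qed

text \<open>Vertical integration of \<open>\<i> * f''\<close> gives a difference of values of
  \<open>f'\<close>, and horizontal integration of that gives the mixed difference. The condition on
  \<open>r\<close> keeps the far corner of the square in the disc. Since \<open>|f''|\<close> is
  nonnegative, the square may be enlarged to the disc.\<close>

lemma mixed_difference_le_integral:
  assumes f: "f holomorphic_on disc" and int: "set_integrable lborel disc (\<lambda>z. cmod (deriv2 f z))"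
    and r: "0 \<le> r" "2 * r\<^sup>2 < 1"
  shows "cmod (f (Complex r r) - f (Complex 0 r) - f (Complex r 0) + f 0)
     \<le> (LINT z:disc|lborel. cmod (deriv2 f z))"
proof -
  let ?F = "\<lambda>p. \<i> * deriv2 f (Complex (fst p) (snd p))"
  let ?S = "cbox (0, 0) (r, r)"
  let ?Q = "cbox 0 (Complex r r)"
  have in_disc: "Complex s t \<in> disc" if "s \<in> {0..r}" "t \<in> {0..r}" for s t
    using that r square_subset_disc[of "Complex s t" r] by simp
  have f1: "deriv f holomorphic_on disc" and f2: "deriv2 f holomorphic_on disc"
    using f by (simp_all add: holomorphic_deriv)
  have contC: "continuous_on A (\<lambda>p. Complex (fst p) (snd p))" for A
    by (auto simp: Complex_eq intro!: continuous_intros)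
  have contF: "continuous_on ?S ?F"
    by (intro continuous_intros continuous_on_compose2[OF holomorphic_on_imp_continuous_on[OF f2] contC])
       (auto intro!: in_disc[simplified])
  have inner: "integral {0..r} (\<lambda>t. ?F (s, t)) = deriv f (Complex s r) - deriv f (Complex s 0)"
    if "s \<in> {0..r}" for s
    using r(1) by (intro integral_unique fundamental_theorem_of_calculus)
      (auto intro!: deriv_vector_vertical[OF f1] in_disc[simplified] that[simplified] simp: that[simplified])
  have outer: "((\<lambda>s. deriv f (Complex s r) - deriv f (Complex s 0)) has_integral
      (f (Complex r r) - f (Complex r 0)) - (f (Complex 0 r) - f (Complex 0 0))) {0..r}"
    using r(1) by (intro fundamental_theorem_of_calculus has_vector_derivative_diff)
      (auto intro!: deriv_vector_horizontal[OF f] in_disc[simplified])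
  have "integral ?S ?F = integral {0..r} (\<lambda>s. integral {0..r} (\<lambda>t. ?F (s, t)))"
    using integral_prod_continuous[OF contF] by simp
  also have "\<dots> = integral {0..r} (\<lambda>s. deriv f (Complex s r) - deriv f (Complex s 0))"
    by (intro integral_cong inner)
  also have "\<dots> = (f (Complex r r) - f (Complex r 0)) - (f (Complex 0 r) - f (Complex 0 0))"
    using outer by (rule integral_unique)
  finally have "f (Complex r r) - f (Complex 0 r) - f (Complex r 0) + f 0 = integral ?S ?F"
    by (simp add: zero_complex.code[symmetric] Complex_eq_0 flip: zero_complex.code)
  also have "cmod (integral ?S ?F) \<le> integral ?S (\<lambda>p. cmod (?F p))"
    by (intro integral_norm_bound_integral integrable_continuous contF continuous_on_norm) simp_all
  also have "\<dots> = integral ?S (\<lambda>p. cmod (deriv2 f (Complex (fst p) (snd p))))"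
    by (simp add: norm_mult)
  also have "\<dots> = (LINT z:?Q|lborel. cmod (deriv2 f z))"
  proof -
    have "continuous_on ?Q (\<lambda>z. cmod (deriv2 f z))"
      using r by (intro continuous_on_norm continuous_on_subset[OF holomorphic_on_imp_continuous_on[OF f2]])
        (auto intro!: square_subset_disc[simplified] simp: in_cbox_complex_iff)
    from set_integral_cbox_complex[OF this] show ?thesis by simp
  qed
  also have "\<dots> \<le> (LINT z:disc|lborel. cmod (deriv2 f z))"
  proof -
    have Q: "?Q \<subseteq> disc"
      using r square_subset_disc by (auto simp: in_cbox_complex_iff)
    show ?thesis
      using int set_integrable_subset[OF int _ Q] Q unfolding set_integrable_def set_lebesgue_integral_def
      by (intro integral_mono) (auto simp: indicator_def)
  qed
  finally show ?thesis .
qed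

lemma deriv2_compose_mult:
  assumes "f holomorphic_on disc" "cmod c \<le> 1" "z \<in> disc"
  shows "deriv2 (\<lambda>w. f (c * w)) z = c\<^sup>2 * deriv2 f (c * z)"
proof -
  have "c * w \<in> disc" if "w \<in> disc" for w
    using that assms(2) mult_le_one[of "cmod c" "cmod w"] by (auto simp: norm_mult intro: le_less_trans[OF mult_left_le_one_le])
  then have "(deriv ^^ 2) (\<lambda>w. f (c * w)) z = c\<^sup>2 * (deriv ^^ 2) f (c * z)"
    by (intro higher_deriv_compose_linear[OF assms(1) open_ball open_ball assms(3)])
  then show ?thesis by (simp add: numeral_2_eq_2)
qed

text \<open>Rotating by the phase \<open>c\<close> of \<open>z\<close> moves the square to the
  coordinate axes. The second derivative of the rotated function gains the factor \<open>c^2\<close>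
  of modulus 1, so the integral does not change.\<close>

lemma mixed_difference_le_integral_disc:
  assumes f: "f holomorphic_on disc" and int: "set_integrable lborel disc (\<lambda>z. cmod (deriv2 f z))"
    and z: "2 * (cmod z)\<^sup>2 < 1"
  shows "cmod (f ((1 + \<i>) * z) - f z - f (\<i> * z) + f 0) \<le> (LINT z:disc|lborel. cmod (deriv2 f z))"
proof -
  obtain c where c: "cmod c = 1" "z = c * of_real (cmod z)"
  proof (cases "z = 0")
    case True
    then show ?thesis using that[of 1] by simp
  next
    case False
    then show ?thesis using that[of "z / of_real (cmod z)"] by (simp add: norm_divide)
  qed
  let ?r = "cmod z" and ?F = "\<lambda>w. f (c * w)"
  have cont: "continuous_on disc (\<lambda>z. cmod (deriv2 f z))"
    by (intro continuous_on_norm holomorphic_on_imp_continuous_on holomorphic_deriv f open_ball)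
  have F: "?F holomorphic_on disc"
    using c(1) by (auto simp: norm_mult intro!: holomorphic_on_compose_gen[OF _ f, unfolded comp_def] holomorphic_intros)
  have F2: "cmod (deriv2 ?F w) = cmod (deriv2 f (c * w))" if "w \<in> disc" for w
    using deriv2_compose_mult[OF f _ that, of c] c(1) by (simp add: norm_mult norm_power)
  have int': "set_integrable lborel disc (\<lambda>z. cmod (deriv2 ?F z))"
    using int unfolding set_integral_disc_rotation(2)[OF cont c(1), symmetric]
    by (rule set_integrable_cong[THEN iffD1, rotated -1]) (use F2 in auto)
  have eq: "(LINT z:disc|lborel. cmod (deriv2 ?F z)) = (LINT z:disc|lborel. cmod (deriv2 f z))"
    unfolding set_integral_disc_rotation(1)[OF cont c(1), symmetric]
    by (rule set_lebesgue_integral_cong) (use F2 in auto)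
  have "(1 + \<i>) * z = c * Complex ?r ?r" "z = c * Complex ?r 0" "\<i> * z = c * Complex 0 ?r"
    by (subst c(2), simp add: Complex_eq algebra_simps)+
  then have "f ((1 + \<i>) * z) - f z - f (\<i> * z) + f 0
      = ?F (Complex ?r ?r) - ?F (Complex 0 ?r) - ?F (Complex ?r 0) + ?F 0"
    by simp
  with mixed_difference_le_integral[OF F int' norm_ge_zero z] show ?thesis
    by (simp only: eq)
qed

text \<open>The bound on \<open>z\<close> says exactly that the farthest point
  \<open>(1 + \<i>) * z\<close> lies in the unit disc. For \<open>n > 0\<close> the constant
  \<open>f 0\<close> disappears.\<close>

lemma higher_deriv_mixed_difference:
  assumes f: "f holomorphic_on disc" and z: "2 * (cmod z)\<^sup>2 < 1" and n: "n > 0"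
  shows "(deriv ^^ n) (\<lambda>z. f ((1 + \<i>) * z) - f z - f (\<i> * z) + f 0) z
    = (1 + \<i>) ^ n * (deriv ^^ n) f ((1 + \<i>) * z) - (deriv ^^ n) f z - \<i> ^ n * (deriv ^^ n) f (\<i> * z)"
    (is "?L = _")
    and "(\<lambda>z. f ((1 + \<i>) * z) - f z - f (\<i> * z) + f 0) holomorphic_on ball 0 (sqrt (1/2))"
proof -
  let ?U = "ball 0 (sqrt (1/2)) :: complex set"
  have U: "w \<in> ?U \<longleftrightarrow> 2 * (cmod w)\<^sup>2 < 1" for w
    using real_less_rsqrt[of "cmod w" "1/2"] power2_less_imp_less[of "cmod w" "sqrt (1/2)"]
      power_strict_mono[of "cmod w" "sqrt (1/2)" 2] by auto
  have s2: "cmod (1 + \<i>) = sqrt 2" by (simp add: cmod_def)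
  have in1: "(1 + \<i>) * w \<in> disc" if "w \<in> ?U" for w
    using that unfolding U by (auto simp: norm_mult s2 intro!: power2_less_imp_less[of _ 1] simp: power_mult_distrib)
  have in2: "w \<in> disc" "\<i> * w \<in> disc" if "w \<in> ?U" for w
    using that unfolding U by (auto simp: norm_mult intro!: power2_less_imp_less[of _ 1])
  have h1: "(\<lambda>w. f ((1 + \<i>) * w)) holomorphic_on ?U"
    using in1 by (intro holomorphic_on_compose_gen[OF _ f, unfolded comp_def] holomorphic_intros) auto
  have h2: "f holomorphic_on ?U"
    using in2 by (intro holomorphic_on_subset[OF f]) auto
  have h3: "(\<lambda>w. f (\<i> * w)) holomorphic_on ?U"
    using in2 by (intro holomorphic_on_compose_gen[OF _ f, unfolded comp_def] holomorphic_intros) auto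
  show "(\<lambda>z. f ((1 + \<i>) * z) - f z - f (\<i> * z) + f 0) holomorphic_on ?U"
    by (intro holomorphic_intros h1 h2 h3)
  have zU: "z \<in> ?U" using z U by simp
  have "?L = (deriv ^^ n) (\<lambda>w. f ((1 + \<i>) * w)) z - (deriv ^^ n) f z - (deriv ^^ n) (\<lambda>w. f (\<i> * w)) z + 0"
    using n
    by (subst higher_deriv_add[OF _ _ open_ball zU] higher_deriv_diff[OF _ _ open_ball zU];
        (intro holomorphic_intros h1 h2 h3)?)+ simp
  also have "(deriv ^^ n) (\<lambda>w. f ((1 + \<i>) * w)) z = (1 + \<i>) ^ n * (deriv ^^ n) f ((1 + \<i>) * z)"
    by (intro higher_deriv_compose_linear[OF f open_ball open_ball zU] in1)
  also have "(deriv ^^ n) (\<lambda>w. f (\<i> * w)) z = \<i> ^ n * (deriv ^^ n) f (\<i> * z)"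
    by (intro higher_deriv_compose_linear[OF f open_ball open_ball zU] in2)
  finally show "?L = (1 + \<i>) ^ n * (deriv ^^ n) f ((1 + \<i>) * z) - (deriv ^^ n) f z - \<i> ^ n * (deriv ^^ n) f (\<i> * z)"
    by simp
qed

text \<open>Cauchy's inequality on the disc of radius 1/8 about \<open>z\<close>: its points have
  modulus at most 5/8, which is below \<open>sqrt (1/2)\<close>, so the mixed difference is bounded
  by the integral there. The radius produces \<open>8 ^ n\<close>.\<close>

lemma higher_deriv_mixed_difference_bound:
  assumes f: "f holomorphic_on disc" and int: "set_integrable lborel disc (\<lambda>z. cmod (deriv2 f z))"
    and z: "cmod z \<le> 1/2" and n: "n > 0"
  shows "cmod ((1 + \<i>) ^ n * (deriv ^^ n) f ((1 + \<i>) * z) - (deriv ^^ n) f z - \<i> ^ n * (deriv ^^ n) f (\<i> * z))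
     \<le> fact n * 8 ^ n * (LINT z:disc|lborel. cmod (deriv2 f z))"
proof -
  let ?h = "\<lambda>z. f ((1 + \<i>) * z) - f z - f (\<i> * z) + f 0"
  have small: "2 * (cmod w)\<^sup>2 < 1" if "cmod w \<le> 5/8" for w
    using power_mono[OF that norm_ge_zero, of 2] by (simp add: power2_eq_square)
  have near: "cmod w \<le> 5/8" if "cmod (z - w) \<le> 1/8" for w
    using norm_triangle_ineq2[of w z] that z by (simp add: norm_minus_commute)
  have s: "5/8 < sqrt (1/2)"
    by (rule real_less_rsqrt) (simp add: power2_eq_square)
  have sub: "cball z (1/8) \<subseteq> ball 0 (sqrt (1/2))"
    using near s by (force simp: dist_norm)
  have hol: "?h holomorphic_on cball z (1/8)"
    \<comment> \<open>The holomorphy claim does not mention the point, so the point 0 is used to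
      discharge the smallness condition.\<close>
    using higher_deriv_mixed_difference(2)[OF f _ n, of 0] sub by (auto intro: holomorphic_on_subset)
  have "cmod ((deriv ^^ n) ?h z) \<le> fact n * (LINT z:disc|lborel. cmod (deriv2 f z)) / (1/8) ^ n"
  proof (rule Cauchy_inequality)
    show "?h holomorphic_on ball z (1/8)"
      using hol by (rule holomorphic_on_subset) auto
    show "cmod (?h w) \<le> (LINT z:disc|lborel. cmod (deriv2 f z))" if "cmod (z - w) = 1/8" for w
      using that by (intro mixed_difference_le_integral_disc[OF f int] small near) simp
  qed (use hol in \<open>auto intro: holomorphic_on_imp_continuous_on\<close>)
  then show ?thesis
    unfolding higher_deriv_mixed_difference(1)[OF f small[OF order_trans[OF z]] n, simplified]
    by (simp add: power_one_over field_simps)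
qed

subsection \<open>Pointwise bounds for functions in \<open>B_1\<close>\<close>

text \<open>At a point \<open>m\<close> maximising the modulus of the third derivative on the closed disc of radius
  \<open>1 / sqrt 2\<close>, apply the Cauchy bound for mixed differences at \<open>z = m / (1 + i)\<close>. The factor
  \<open>cmod (1 + i) ^ 3 > 2\<close> lets the other two corner terms be absorbed.\<close>

lemma B1_bounds_small_disc:
  assumes f: "f holomorphic_on disc" and int: "set_integrable lborel disc (\<lambda>z. cmod (deriv2 f z))"
    and y: "cmod y \<le> sqrt (1/2)"
  shows "cmod (f y) \<le> cmod (f 0) + cmod (deriv f 0) + 4000 * (LINT z:disc|lborel. cmod (deriv2 f z))"
proof -
  define I where "I = (LINT z:disc|lborel. cmod (deriv2 f z))"
  let ?K = "cball 0 (sqrt (1/2)) :: complex set"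
  have I0: "0 \<le> I"
    unfolding I_def set_lebesgue_integral_def by (intro integral_nonneg_AE) auto
  have s1: "sqrt (1/2) < 1" by simp
  have K: "?K \<subseteq> disc" by (auto simp: dist_norm intro: le_less_trans[OF _ s1])
  have s2: "cmod (1 + \<i>) = sqrt 2" by (simp add: cmod_def)
  have hol: "(deriv ^^ n) f holomorphic_on disc" for n
    using f by (intro holomorphic_higher_deriv) auto
  have der: "((deriv ^^ n) f has_field_derivative (deriv ^^ Suc n) f w) (at w within ?K)" if "w \<in> ?K" for n w
    using holomorphic_derivI[OF hol open_ball, of w n] that K by (auto intro: has_field_derivative_at_within)
  \<comment> \<open>At the origin all three terms coincide, with total coefficient
    \<open>(1 + \<i>)^2 - 1 - \<i>^2 = 2 * \<i>\<close>. Halving the Cauchy bound 2! * 8^2 = 128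
    gives 64.\<close>
  have D2: "cmod ((deriv ^^ 2) f 0) \<le> 64 * I"
  proof -
    have "(1 + \<i>) ^ 2 * (deriv ^^ 2) f 0 - (deriv ^^ 2) f 0 - \<i> ^ 2 * (deriv ^^ 2) f 0
        = 2 * \<i> * (deriv ^^ 2) f 0"
      by (simp add: power2_eq_square algebra_simps)
    moreover have "cmod ((1 + \<i>) ^ 2 * (deriv ^^ 2) f 0 - (deriv ^^ 2) f 0 - \<i> ^ 2 * (deriv ^^ 2) f 0) \<le> 128 * I"
      using higher_deriv_mixed_difference_bound[OF f int, of 0 2] by (simp add: I_def fact_numeral del: power2_i)
    ultimately show ?thesis by (simp only: norm_mult) simp
  qed
  have D3: "cmod ((deriv ^^ 3) f w) \<le> 3840 * I" if "w \<in> ?K" for w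
  proof -
    have "continuous_on ?K (\<lambda>w. cmod ((deriv ^^ 3) f w))"
      by (intro continuous_on_norm holomorphic_on_imp_continuous_on holomorphic_on_subset[OF hol K])
    then obtain m where m: "m \<in> ?K" "\<And>w. w \<in> ?K \<Longrightarrow> cmod ((deriv ^^ 3) f w) \<le> cmod ((deriv ^^ 3) f m)"
      using continuous_attains_sup[of ?K "\<lambda>w. cmod ((deriv ^^ 3) f w)"] that by fastforce
    define z where "z = m / (1 + \<i>)"
    have mz: "(1 + \<i>) * z = m" by (simp add: z_def complex_eq_iff)
    have "cmod z = cmod m / sqrt 2" by (simp add: z_def norm_divide s2)
    also have "\<dots> \<le> sqrt (1/2) / sqrt 2" using m(1) by (intro divide_right_mono) auto
    \<comment> \<open>This puts \<open>z\<close> and \<open>\<i> * z\<close> inside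
      \<open>?K\<close>, where \<open>m\<close> is maximal, and within the range of the Cauchy
      bound.\<close>
    finally have z: "cmod z \<le> 1/2" by (simp add: real_sqrt_divide)
    have half: "1/2 \<le> sqrt (1/2)"
      by (rule real_le_rsqrt) (simp add: power2_eq_square)
    have zK: "z \<in> ?K" "\<i> * z \<in> ?K" using z half by (auto simp: norm_mult)
    have "sqrt 2 ^ 3 * cmod ((deriv ^^ 3) f m) = cmod ((1 + \<i>) ^ 3 * (deriv ^^ 3) f m)"
      by (simp add: norm_mult norm_power s2)
    also have "\<dots> \<le> cmod ((1 + \<i>) ^ 3 * (deriv ^^ 3) f m - (deriv ^^ 3) f z - \<i> ^ 3 * (deriv ^^ 3) f (\<i> * z))
        + cmod ((deriv ^^ 3) f z) + cmod (\<i> ^ 3 * (deriv ^^ 3) f (\<i> * z))"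
      by norm
    also have "cmod ((1 + \<i>) ^ 3 * (deriv ^^ 3) f m - (deriv ^^ 3) f z - \<i> ^ 3 * (deriv ^^ 3) f (\<i> * z)) \<le> 3072 * I"
      using higher_deriv_mixed_difference_bound[OF f int z, of 3] by (simp add: mz I_def fact_numeral)
    also have "cmod ((deriv ^^ 3) f z) \<le> cmod ((deriv ^^ 3) f m)"
      by (rule m(2)[OF zK(1)])
    also have "cmod (\<i> ^ 3 * (deriv ^^ 3) f (\<i> * z)) \<le> cmod ((deriv ^^ 3) f m)"
      using m(2)[OF zK(2)] by (simp add: norm_mult norm_power)
    finally have *: "sqrt 2 ^ 3 * cmod ((deriv ^^ 3) f m) \<le> 3072 * I + cmod ((deriv ^^ 3) f m) + cmod ((deriv ^^ 3) f m)"
      by simp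
    \<comment> \<open>The cube of \<open>sqrt 2\<close> is \<open>2 * sqrt 2\<close>, hence at least
      2.8. Absorbing two copies of the maximum leaves the factor 0.8, and 3072 / 0.8 = 3840, where
      3072 = 3! * 8^3.\<close>
    have "1.4 \<le> sqrt 2" by (rule real_le_rsqrt) (simp add: power2_eq_square)
    then have "2.8 \<le> sqrt 2 ^ 3" by (simp add: power3_eq_cube)
    then have "2.8 * cmod ((deriv ^^ 3) f m) \<le> sqrt 2 ^ 3 * cmod ((deriv ^^ 3) f m)"
      by (intro mult_right_mono) auto
    with * have "cmod ((deriv ^^ 3) f m) \<le> 3840 * I" by simp
    with m(2)[OF that] show ?thesis by simp
  qed
  \<comment> \<open>The mean value inequality on a convex disc of radius below 1 lowers the order by
    one. Three uses lead from the third derivative to \<open>f\<close>.\<close>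
  have step: "cmod ((deriv ^^ n) f w) \<le> cmod ((deriv ^^ n) f 0) + B"
    if B: "\<And>w. w \<in> ?K \<Longrightarrow> cmod ((deriv ^^ Suc n) f w) \<le> B" and w: "w \<in> ?K" for n B w
  proof -
    have "cmod ((deriv ^^ n) f w - (deriv ^^ n) f 0) \<le> B * cmod (w - 0)"
      by (rule field_differentiable_bound[OF convex_cball der B w]) auto
    also have "\<dots> \<le> B * 1"
    proof (rule mult_left_mono)
      show "0 \<le> B" using B[OF w] norm_ge_zero order_trans by blast
      show "cmod (w - 0) \<le> 1" using w s1 by (auto intro: order_trans)
    qed
    finally show ?thesis
      using norm_triangle_ineq2[of "(deriv ^^ n) f w" "(deriv ^^ n) f 0"] by simp
  qed
  \<comment> \<open>The sum 64 + 3840 is rounded up to 4000.\<close>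
  have B2: "cmod ((deriv ^^ Suc 1) f w) \<le> 4000 * I" if "w \<in> ?K" for w
  proof -
    have "cmod ((deriv ^^ 2) f w) \<le> cmod ((deriv ^^ 2) f 0) + 3840 * I"
      using D3 that by (intro step) (auto simp: numeral_3_eq_3)
    with D2 I0 show ?thesis by (simp add: numeral_2_eq_2)
  qed
  have B1: "cmod ((deriv ^^ Suc 0) f w) \<le> cmod (deriv f 0) + 4000 * I" if "w \<in> ?K" for w
    using step[OF B2 that] by simp
  show ?thesis
    using step[OF B1, of y] y by (simp add: I_def)
qed

lemma B1_norm_ge:
  shows "(LINT z:disc|lborel. cmod (deriv2 f z)) \<le> 4 * B1_norm f"
    and "cmod (f 0) + cmod (deriv f 0) \<le> B1_norm f"
proof -
  let ?I = "LINT z:disc|lborel. cmod (deriv2 f z)"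
  have I: "0 \<le> ?I"
    unfolding set_lebesgue_integral_def by (intro integral_nonneg_AE) auto
  \<comment> \<open>The constant 4 comes from \<open>pi < 4\<close>.\<close>
  then have "?I / 4 \<le> ?I / pi"
    using pi_less_4 pi_gt_zero by (intro divide_left_mono) auto
  moreover have "0 \<le> ?I / pi" using I by simp
  ultimately have "?I \<le> 4 * (cmod (f 0) + cmod (deriv f 0) + ?I / pi)" "0 \<le> ?I / pi"
    using norm_ge_zero[of "f 0"] norm_ge_zero[of "deriv f 0"] by (argo, argo)
  then show "?I \<le> 4 * B1_norm f" "cmod (f 0) + cmod (deriv f 0) \<le> B1_norm f"
    by (auto simp: B1_norm_def)
qed

lemma B1_norm_nonneg: "0 \<le> B1_norm f"
  using B1_norm_ge(2)[of f] norm_ge_zero[of "f 0"] norm_ge_zero[of "deriv f 0"] by linarith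

text \<open>With \<open>z = w / (1 + \<i>)\<close>, the value \<open>f w\<close> is the mixed
  difference corrected by \<open>f\<close> at three points of the disc of radius
  \<open>sqrt (1/2)\<close>, where a bound is already known.\<close>

lemma B1_bounded:
  assumes "in_B1 f" "w \<in> disc"
  shows "cmod (f w) \<le> 50000 * B1_norm f"
proof -
  have f: "f holomorphic_on disc" and int: "set_integrable lborel disc (\<lambda>z. cmod (deriv2 f z))"
    using assms(1) by (auto simp: in_B1_def)
  define I where "I = (LINT z:disc|lborel. cmod (deriv2 f z))"
  have I: "I \<le> 4 * B1_norm f" and f0: "cmod (f 0) + cmod (deriv f 0) \<le> B1_norm f"
    using B1_norm_ge by (auto simp: I_def)
  define z where "z = w / (1 + \<i>)"
  have wz: "(1 + \<i>) * z = w" by (simp add: z_def complex_eq_iff)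
  have "cmod z = cmod w / sqrt 2" by (simp add: z_def norm_divide cmod_def[of "1 + \<i>"])
  moreover have "(cmod w)\<^sup>2 < 1" using assms(2) by (simp add: power_less_one_iff abs_square_less_1)
  ultimately have z: "2 * (cmod z)\<^sup>2 < 1" by (simp add: power_divide)
  then have z': "cmod z \<le> sqrt (1/2)" by (intro real_le_rsqrt) simp
  have "cmod (f w) = cmod ((f ((1 + \<i>) * z) - f z - f (\<i> * z) + f 0) + f z + f (\<i> * z) - f 0)"
    by (simp add: wz)
  also have "\<dots> \<le> cmod (f ((1 + \<i>) * z) - f z - f (\<i> * z) + f 0) + cmod (f z) + cmod (f (\<i> * z)) + cmod (f 0)"
    by norm
  also have "\<dots> \<le> I + (B1_norm f + 4000 * I) + (B1_norm f + 4000 * I) + B1_norm f"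
  proof -
    have "cmod (f 0) \<le> B1_norm f"
      using f0 norm_ge_zero[of "deriv f 0"] by linarith
    moreover have "cmod (f x) \<le> B1_norm f + 4000 * I" if "cmod x \<le> sqrt (1/2)" for x
      using B1_bounds_small_disc[OF f int that] f0 by (simp add: I_def)
    moreover have "cmod (\<i> * z) \<le> sqrt (1/2)" using z' by (simp add: norm_mult)
    ultimately show ?thesis
      using mixed_difference_le_integral_disc[OF f int z] z' by (intro add_mono) (simp_all add: I_def)
  qed
  \<comment> \<open>The total is 8001 copies of \<open>I\<close> and three of the norm. By
    \<open>I \<le> 4 * B1_norm f\<close> this is at most 32007 norms.\<close>
  also have "\<dots> \<le> 50000 * B1_norm f"
    using I B1_norm_nonneg[of f] by simp
  finally show ?thesis .
qed

text \<open>Cauchy's inequality on the disc of radius \<open>r = (1 - |w|) / 2\<close>, which stays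
  inside the unit disc. The factor \<open>4 ^ n\<close> arises from
  \<open>1 - |w|^2 \<le> 2 * (1 - |w|) = 4 * r\<close>.\<close>

lemma B1_higher_deriv_bound:
  assumes "in_B1 f" "w \<in> disc"
  shows "cmod ((deriv ^^ n) f w) * (1 - (cmod w)\<^sup>2) ^ n \<le> fact n * 4 ^ n * 50000 * B1_norm f"
proof -
  define r where "r = (1 - cmod w) / 2"
  have r: "0 < r" using assms(2) by (simp add: r_def)
  have sub: "cball w r \<subseteq> disc"
  proof
    fix x assume "x \<in> cball w r"
    then show "x \<in> disc"
      using norm_triangle_ineq2[of x w] assms(2) by (simp add: dist_norm norm_minus_commute r_def field_simps)
  qed
  have f: "f holomorphic_on disc" using assms(1) by (simp add: in_B1_def)
  have "cmod ((deriv ^^ n) f w) \<le> fact n * (50000 * B1_norm f) / r ^ n"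
  proof (rule Cauchy_inequality[OF _ _ r])
    show "f holomorphic_on ball w r" using f by (rule holomorphic_on_subset) (use sub ball_subset_cball in blast)
    show "continuous_on (cball w r) f"
      by (intro holomorphic_on_imp_continuous_on holomorphic_on_subset[OF f sub])
    show "cmod (f x) \<le> 50000 * B1_norm f" if "cmod (w - x) = r" for x
      using that sub by (intro B1_bounded assms) (auto simp: dist_norm)
  qed
  then have *: "cmod ((deriv ^^ n) f w) * r ^ n \<le> fact n * (50000 * B1_norm f)"
    using r by (simp add: field_simps)
  have "1 - (cmod w)\<^sup>2 = (1 - cmod w) * (1 + cmod w)" by (simp add: power2_eq_square algebra_simps)
  also have "\<dots> \<le> (1 - cmod w) * 2" using assms(2) by (intro mult_left_mono) auto
  finally have "1 - (cmod w)\<^sup>2 \<le> 4 * r" by (simp add: r_def)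
  moreover have "0 \<le> 1 - (cmod w)\<^sup>2" using assms(2) by (simp add: abs_square_le_1)
  ultimately have "(1 - (cmod w)\<^sup>2) ^ n \<le> 4 ^ n * r ^ n"
    by (metis power_mono power_mult_distrib)
  then have "cmod ((deriv ^^ n) f w) * (1 - (cmod w)\<^sup>2) ^ n \<le> 4 ^ n * (cmod ((deriv ^^ n) f w) * r ^ n)"
    using mult_left_mono[OF _ norm_ge_zero] by (metis mult.left_commute)
  also have "\<dots> \<le> 4 ^ n * (fact n * (50000 * B1_norm f))"
    using * by (intro mult_left_mono) auto
  finally show ?thesis by (simp add: mult_ac)
qed

subsection \<open>Test functions\<close>

text \<open>For fixed real part \<open>x\<close>, integration in the imaginary part gives a
  difference of arctangents, at most \<open>pi\<close>, over \<open>(c - x)^2\<close>. The latter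
  has antiderivative \<open>pi / (c - x)\<close>.\<close>

lemma integral_inverse_cube_le:
  assumes "1 < c"
  shows "(LINT z:cbox (Complex (-1) (-1)) (Complex 1 1)|lborel. 1 / ((c - Re z) * ((c - Re z)\<^sup>2 + (Im z)\<^sup>2))) \<le> pi / (c - 1)"
    (is "(LINT z:?Q|lborel. ?g z) \<le> _")
proof -
  let ?k = "\<lambda>p. 1 / ((c - fst p) * ((c - fst p)\<^sup>2 + (snd p)\<^sup>2))"
  let ?S = "cbox (-1, -1) (1, 1) :: (real \<times> real) set"
  have pos: "(c - x) * ((c - x)\<^sup>2 + y\<^sup>2) > 0" if "x \<le> 1" for x y
    using that assms by (intro mult_pos_pos add_pos_nonneg) auto
  have contg: "continuous_on ?Q ?g"
    by (intro continuous_intros ballI) (auto simp: in_cbox_complex_iff dest!: pos)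
  have contk: "continuous_on ?S ?k"
    by (intro continuous_intros ballI) (auto dest!: pos)
  have inner: "integral {-1..1} (\<lambda>y. ?k (x, y)) = (arctan (1 / (c - x)) - arctan (- 1 / (c - x))) / (c - x)\<^sup>2"
    if "x \<in> {-1..1}" for x
  proof -
    have p: "c - x > 0" using that assms by auto
    have "((\<lambda>y. ?k (x, y)) has_integral arctan (1 / (c - x)) / (c - x)\<^sup>2 - arctan (- 1 / (c - x)) / (c - x)\<^sup>2) {-1..1}"
    proof (rule fundamental_theorem_of_calculus)
      fix y :: real
      have ne: "(c - x)\<^sup>2 + y\<^sup>2 \<noteq> 0" using p by (simp add: sum_power2_eq_zero_iff)
      have "((\<lambda>y. arctan (y / (c - x)) / (c - x)\<^sup>2) has_real_derivative ?k (x, y)) (at y within {-1..1})"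
        using p ne
        by (auto intro!: derivative_eq_intros simp: divide_simps power2_eq_square)
      then show "((\<lambda>y. arctan (y / (c - x)) / (c - x)\<^sup>2) has_vector_derivative ?k (x, y)) (at y within {-1..1})"
        by (simp add: has_real_derivative_iff_has_vector_derivative)
    qed simp
    then show ?thesis by (simp add: integral_unique diff_divide_distrib)
  qed
  have outer: "((\<lambda>x. pi / (c - x)\<^sup>2) has_integral pi / (c - 1) - pi / (c - - 1)) {-1..1}"
  proof (rule fundamental_theorem_of_calculus)
    fix x :: real assume "x \<in> {-1..1}"
    then have "c - x \<noteq> 0" using assms by auto
    then show "((\<lambda>x. pi / (c - x)) has_vector_derivative pi / (c - x)\<^sup>2) (at x within {-1..1})"
      unfolding has_real_derivative_iff_has_vector_derivative[symmetric]
      by (auto intro!: derivative_eq_intros simp: power2_eq_square)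
  qed simp
  have "(LINT z:?Q|lborel. ?g z) = integral ?S ?k"
    using set_integral_cbox_complex[OF contg] by simp
  also have "\<dots> = integral {-1..1} (\<lambda>x. integral {-1..1} (\<lambda>y. ?k (x, y)))"
    using integral_prod_continuous[OF contk] by simp
  also have "\<dots> = integral {-1..1} (\<lambda>x. (arctan (1 / (c - x)) - arctan (- 1 / (c - x))) / (c - x)\<^sup>2)"
    by (intro integral_cong inner)
  also have "\<dots> \<le> integral {-1..1} (\<lambda>x. pi / (c - x)\<^sup>2)"
  proof (rule integral_le)
    show "(\<lambda>x. pi / (c - x)\<^sup>2) integrable_on {-1..1}" using outer by blast
    show "(\<lambda>x. (arctan (1 / (c - x)) - arctan (- 1 / (c - x))) / (c - x)\<^sup>2) integrable_on {-1..1}"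
      using assms by (intro integrable_continuous_real continuous_intros) auto
    show "(arctan (1 / (c - x)) - arctan (- 1 / (c - x))) / (c - x)\<^sup>2 \<le> pi / (c - x)\<^sup>2" for x
      using arctan_ubound[of "1 / (c - x)"] arctan_lbound[of "- 1 / (c - x)"]
      by (intro divide_right_mono) auto
  qed
  also have "\<dots> = pi / (c - 1) - pi / (c + 1)"
    using outer by (simp add: integral_unique)
  also have "\<dots> \<le> pi / (c - 1)" using assms by simp
  finally show ?thesis .
qed

text \<open>The centre \<open>2 - t\<close> lies at distance \<open>1 - t\<close> from the disc for every \<open>t\<close>, whereas \<open>1 / t\<close> would require
  small \<open>t\<close> to be treated separately. The right-hand side is a lower bound for the cube that
  integrates explicitly in \<open>Im z\<close>.\<close>

lemma inverse_cube_le: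
  assumes t: "0 \<le> t" "t < 1" and z: "z \<in> disc"
  shows "1 / cmod (1 - of_real t * z) ^ 3 \<le> 27 * (1 / ((2 - t - Re z) * ((2 - t - Re z)\<^sup>2 + (Im z)\<^sup>2)))"
proof -
  let ?w = "of_real (2 - t) - z"
  have z1: "cmod z \<le> 1" using z by simp
  have tz: "cmod (of_real t * z) \<le> t" using t z1 by (simp add: norm_mult mult_left_le)
  have 1: "1 - t \<le> cmod (1 - of_real t * z)"
    using norm_triangle_ineq2[of 1 "of_real t * z"] tz by simp
  have "cmod (of_real (1 - t) * z) \<le> 1 - t"
    using t z1 mult_left_le[of "cmod z" "1 - t"] by (simp add: norm_mult del: of_real_diff)
  moreover have "cmod (1 - z) = cmod ((1 - of_real t * z) - of_real (1 - t) * z)" by (simp add: algebra_simps)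
  \<comment> \<open>Both \<open>1 - t\<close> and \<open>|1 - z|\<close> are compared with
    \<open>|1 - t z|\<close>, at costs 1 and 2. Their sum dominates \<open>|?w|\<close>, giving the
    constant 3 and, after cubing, 27.\<close>
  ultimately have 2: "cmod (1 - z) \<le> 2 * cmod (1 - of_real t * z)"
    using 1 norm_triangle_ineq4[of "1 - of_real t * z" "of_real (1 - t) * z"] by linarith
  have "cmod ?w = cmod (of_real (1 - t) + (1 - z))" by (rule arg_cong[where f = cmod]) simp
  then have "cmod ?w \<le> 3 * cmod (1 - of_real t * z)"
    using 1 2 t norm_triangle_ineq[of "of_real (1 - t)" "1 - z"] norm_of_real[of "1 - t", where 'a = complex]
    by linarith
  moreover have re: "0 < 2 - t - Re z" "2 - t - Re z \<le> cmod ?w"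
    using z1 t complex_Re_le_cmod[of z] complex_Re_le_cmod[of ?w] by auto
  ultimately have "cmod ?w ^ 3 \<le> 27 * cmod (1 - of_real t * z) ^ 3"
    using power_mono[of "cmod ?w" "3 * cmod (1 - of_real t * z)" 3] by (simp add: power_mult_distrib)
  moreover have "(2 - t - Re z) * ((2 - t - Re z)\<^sup>2 + (Im z)\<^sup>2) \<le> cmod ?w ^ 3"
  proof -
    have "(cmod ?w)\<^sup>2 = (2 - t - Re z)\<^sup>2 + (Im z)\<^sup>2" by (simp add: cmod_power2)
    then show ?thesis
      using mult_right_mono[OF re(2), of "(cmod ?w)\<^sup>2"] by (simp only: power3_eq_cube power2_eq_square mult.assoc) (simp add: mult.commute)
  qed
  moreover have "0 < (2 - t - Re z) * ((2 - t - Re z)\<^sup>2 + (Im z)\<^sup>2)"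
    using re by (intro mult_pos_pos add_pos_nonneg) auto
  moreover have "0 < cmod (1 - of_real t * z)" using 1 t by linarith
  ultimately show ?thesis by (simp add: divide_simps)
qed

lemma mult_cnj_in_disc:
  assumes "a \<in> disc" "cmod z \<le> 1"
  shows "cmod (cnj a * z) < 1"
  using assms mult_left_le[of "cmod z" "cmod a"] by (simp add: norm_mult)

text \<open>Rotation replaces \<open>cnj a\<close> by \<open>t = |a|\<close>, and the comparison
  with centre \<open>2 - t\<close> bounds the integral by \<open>27 * pi / (1 - t)\<close>.
  Multiplication by \<open>1 - t^2\<close> leaves \<open>27 * pi * (1 + t)\<close>, which is bounded
  uniformly in \<open>a\<close>.\<close>

lemma kernel_integral:
  assumes a: "a \<in> disc"
  shows "set_integrable lborel disc (\<lambda>z. 1 / cmod (1 - cnj a * z) ^ 3)"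
    and "(1 - (cmod a)\<^sup>2) * (LINT z:disc|lborel. 1 / cmod (1 - cnj a * z) ^ 3) \<le> 54 * pi"
proof -
  define t where "t = cmod a"
  have t: "0 \<le> t" "t < 1" using a by (auto simp: t_def)
  obtain c where c: "cmod c = 1" "cnj a = of_real t * c"
  proof (cases "a = 0")
    case True
    then show ?thesis using that[of 1] by (simp add: t_def)
  next
    case False
    then show ?thesis using that[of "cnj a / of_real t"] by (simp add: norm_divide t_def)
  qed
  let ?g = "\<lambda>z. 1 / cmod (1 - of_real t * z) ^ 3"
  let ?k = "\<lambda>z. 27 * (1 / ((2 - t - Re z) * ((2 - t - Re z)\<^sup>2 + (Im z)\<^sup>2)))"
  let ?Q = "cbox (Complex (-1) (-1)) (Complex 1 1)"
  have ne: "1 - of_real t * z \<noteq> 0" if "cmod z \<le> 1" for z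
    using mult_cnj_in_disc[of "of_real t" z] that t by auto
  have contg': "continuous_on (cball 0 1) ?g"
    by (intro continuous_intros ballI) (use ne in auto)
  have contg: "continuous_on disc ?g"
    by (rule continuous_on_subset[OF contg']) auto
  have "set_integrable lborel (cball 0 1) ?g"
    unfolding set_integrable_def by (intro borel_integrable_compact contg' compact_cball)
  then have intg: "set_integrable lborel disc ?g"
    by (rule set_integrable_subset) auto
  have eq: "1 / cmod (1 - cnj a * z) ^ 3 = ?g (c * z)" for z
    by (simp add: c(2) mult.assoc)
  show "set_integrable lborel disc (\<lambda>z. 1 / cmod (1 - cnj a * z) ^ 3)"
    unfolding eq set_integral_disc_rotation(2)[OF contg c(1)] by (rule intg)
  have pos: "(2 - t - Re z) * ((2 - t - Re z)\<^sup>2 + (Im z)\<^sup>2) > 0" if "z \<in> ?Q" for z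
    using that t by (intro mult_pos_pos add_pos_nonneg) (auto simp: in_cbox_complex_iff)
  have contk: "continuous_on ?Q ?k"
    by (intro continuous_intros ballI) (auto dest!: pos)
  have "set_integrable lborel ?Q ?k"
    unfolding set_integrable_def by (intro borel_integrable_compact contk compact_cbox)
  moreover have sub: "disc \<subseteq> ?Q"
  proof
    fix z :: complex assume "z \<in> disc"
    then show "z \<in> ?Q"
      using abs_Re_le_cmod[of z] abs_Im_le_cmod[of z] by (auto simp: in_cbox_complex_iff abs_le_iff)
  qed
  moreover have "?k z \<ge> 0" if "z \<in> ?Q" for z
    using pos[OF that] by simp
  ultimately have "(LINT z:disc|lborel. ?g z) \<le> (LINT z:?Q|lborel. ?k z)"
    using intg inverse_cube_le[OF t] unfolding set_integrable_def set_lebesgue_integral_def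
    by (intro integral_mono) (auto simp: indicator_def)
  also have "\<dots> = 27 * (LINT z:?Q|lborel. 1 / ((2 - t - Re z) * ((2 - t - Re z)\<^sup>2 + (Im z)\<^sup>2)))"
    by (rule set_integral_mult_right)
  also have "\<dots> \<le> 27 * (pi / (1 - t))"
    using integral_inverse_cube_le[of "2 - t"] t by simp
  finally have "(1 - t\<^sup>2) * (LINT z:disc|lborel. ?g z) \<le> (1 - t\<^sup>2) * (27 * (pi / (1 - t)))"
    using t by (intro mult_left_mono) (auto simp: abs_square_le_1)
  also have "\<dots> = 27 * pi * (1 + t)"
    using t by (simp add: field_simps power2_eq_square)
  also have "\<dots> \<le> 54 * pi" using t by simp
  finally show "(1 - (cmod a)\<^sup>2) * (LINT z:disc|lborel. 1 / cmod (1 - cnj a * z) ^ 3) \<le> 54 * pi"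
    unfolding eq set_integral_disc_rotation(1)[OF contg c(1)] by (simp add: t_def)
qed

lemma higher_deriv_test_fun:
  assumes a: "a \<in> disc" and z: "z \<in> disc"
  shows "(deriv ^^ n) (test_fun j a) z
    = of_nat (pochhammer j n) * cnj a ^ n * (1 - of_real ((cmod a)\<^sup>2)) ^ j / (1 - cnj a * z) ^ (j + n)"
  using z
proof (induction n arbitrary: z)
  case 0
  then show ?case by (simp add: test_fun_def power_divide)
next
  case (Suc n)
  let ?s = "of_nat (pochhammer j n) * cnj a ^ n * (1 - of_real ((cmod a)\<^sup>2)) ^ j :: complex"
  have ne: "1 - cnj a * z \<noteq> 0" using mult_cnj_in_disc[OF a, of z] Suc.prems by auto
  have "((\<lambda>w. ?s / (1 - cnj a * w) ^ (j + n)) has_field_derivative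
      ?s * (of_nat (j + n) * cnj a / (1 - cnj a * z) ^ Suc (j + n))) (at z)"
  proof -
    have "((\<lambda>w. inverse (1 - cnj a * w)) has_field_derivative cnj a * inverse (1 - cnj a * z) ^ 2) (at z)"
      using ne by (auto intro!: derivative_eq_intros simp: power2_eq_square)
    from DERIV_cmult[OF DERIV_power[OF this, of "j + n"], of ?s]
    have "((\<lambda>w. ?s * inverse (1 - cnj a * w) ^ (j + n)) has_field_derivative
      ?s * (of_nat (j + n) * (cnj a * inverse (1 - cnj a * z) ^ 2 * inverse (1 - cnj a * z) ^ (j + n - Suc 0)))) (at z)"
      by simp
    moreover have "of_nat (j + n) * (cnj a * inverse (1 - cnj a * z) ^ 2 * inverse (1 - cnj a * z) ^ (j + n - Suc 0))
      = of_nat (j + n) * cnj a / (1 - cnj a * z) ^ Suc (j + n)"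
      \<comment> \<open>The exponent \<open>j + n - Suc 0\<close> is truncated when
        \<open>j + n = 0\<close>. Both sides then vanish because of the factor
        \<open>of_nat (j + n)\<close>.\<close>
      by (cases "j + n") (simp_all add: divide_inverse power_inverse power2_eq_square mult_ac)
    ultimately show ?thesis
      by (simp only: divide_inverse power_inverse)
  qed
  then have "((deriv ^^ n) (test_fun j a) has_field_derivative
      ?s * (of_nat (j + n) * cnj a / (1 - cnj a * z) ^ Suc (j + n))) (at z)"
    by (rule has_field_derivative_transform_within_open[OF _ open_ball Suc.prems]) (simp add: Suc.IH)
  then show ?case
    by (simp add: DERIV_imp_deriv pochhammer_Suc mult_ac)
qed

lemma test_fun_holomorphic:
  assumes "a \<in> disc"
  shows "test_fun j a holomorphic_on disc"
  unfolding test_fun_def using mult_cnj_in_disc[OF assms]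
  by (intro holomorphic_intros) (metis eq_iff_diff_eq_0 less_irrefl less_imp_le mem_ball_0 norm_one)

text \<open>The second derivative has \<open>s ^ j\<close> over the power \<open>j + 2\<close> of
  \<open>|1 - cnj a * z|\<close>. Since \<open>s\<close> is at most twice this modulus,
  \<open>j - 1\<close> of the quotients are bounded by 2 each, leaving \<open>s\<close> times the
  integrable inverse cube.\<close>

lemma test_fun_B1:
  assumes a: "a \<in> disc" and j: "j \<in> {1..4}"
  shows "in_B1 (test_fun j a)" "B1_norm (test_fun j a) \<le> 10000"
proof -
  define s where "s = 1 - (cmod a)\<^sup>2"
  have s: "0 < s" "s \<le> 1" using a by (auto simp: s_def abs_square_less_1)
  have s': "1 - of_real ((cmod a)\<^sup>2) = (of_real s :: complex)" by (simp add: s_def)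
  have a1: "cmod a \<le> 1" using a by simp
  \<comment> \<open>Here \<open>pochhammer j 2\<close> is \<open>j * (j + 1)\<close>, at most 4 *
    5.\<close>
  have p: "pochhammer j 2 \<le> 20"
    using j mult_mono[of j 4 "Suc j" 5] by (auto simp: numeral_2_eq_2 pochhammer_Suc)
  have kb: "cmod (deriv2 (test_fun j a) z) \<le> 160 * s * (1 / cmod (1 - cnj a * z) ^ 3)" if z: "z \<in> disc" for z
  proof -
    let ?w = "cmod (1 - cnj a * z)"
    have "1 - cmod a \<le> ?w"
      using norm_triangle_ineq2[of 1 "cnj a * z"] mult_left_le[of "cmod z" "cmod a"] z by (simp add: norm_mult)
    moreover have "s = (1 - cmod a) * (1 + cmod a)" by (simp add: s_def power2_eq_square algebra_simps)
    moreover have "(1 - cmod a) * (1 + cmod a) \<le> (1 - cmod a) * 2" using a by (intro mult_left_mono) auto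
    ultimately have sw: "s \<le> 2 * ?w" by simp
    have w: "0 < ?w" using mult_cnj_in_disc[OF a, of z] z by auto
    obtain m where m: "j = Suc m" "m \<le> 3" using j by (cases j) auto
    have "s ^ m \<le> (2 * ?w) ^ m" using sw s by (intro power_mono) auto
    also have "\<dots> = 2 ^ m * ?w ^ m" by (simp add: power_mult_distrib)
    also have "\<dots> \<le> 8 * ?w ^ m"
      using m power_increasing[of m 3 "2::real"] by (intro mult_right_mono) auto
    finally have sm: "s ^ m / ?w ^ m \<le> 8" using w by (simp add: field_simps)
    have "deriv2 (test_fun j a) z = of_nat (pochhammer j 2) * cnj a ^ 2 * of_real s ^ j / (1 - cnj a * z) ^ (j + 2)"
      using higher_deriv_test_fun[OF a z, of 2 j] unfolding s' by (simp add: numeral_2_eq_2)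
    then have "cmod (deriv2 (test_fun j a) z) = real (pochhammer j 2) * cmod a ^ 2 * (s ^ j / ?w ^ (j + 2))"
      using s by (simp add: norm_mult norm_divide norm_power)
    also have "\<dots> \<le> 20 * 1 * (s ^ j / ?w ^ (j + 2))"
      using p a1 s by (intro mult_right_mono mult_mono) (auto simp: power_le_one simp flip: of_nat_le_iff)
    also have "s ^ j / ?w ^ (j + 2) = s / ?w ^ 3 * (s ^ m / ?w ^ m)"
      using w by (simp add: m power3_eq_cube)
    also have "20 * 1 * (s / ?w ^ 3 * (s ^ m / ?w ^ m)) \<le> 20 * 1 * (s / ?w ^ 3 * 8)"
      using sm s w by (intro mult_left_mono) auto
    finally show ?thesis by simp
  qed
  have hol: "test_fun j a holomorphic_on disc" by (rule test_fun_holomorphic[OF a])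
  have cont: "continuous_on disc (\<lambda>z. cmod (deriv2 (test_fun j a) z))"
    by (intro continuous_on_norm holomorphic_on_imp_continuous_on holomorphic_deriv hol open_ball)
  have k: "set_integrable lborel disc (\<lambda>z. 160 * s * (1 / cmod (1 - cnj a * z) ^ 3))"
    using kernel_integral(1)[OF a] by (intro set_integrable_mult_right) auto
  have int: "set_integrable lborel disc (\<lambda>z. cmod (deriv2 (test_fun j a) z))"
  proof (rule set_integrable_bound[OF k])
    show "set_borel_measurable lborel disc (\<lambda>z. cmod (deriv2 (test_fun j a) z))"
      unfolding set_borel_measurable_def
      using borel_measurable_continuous_on_indicator[OF _ cont] by simp
    show "AE z in lborel. z \<in> disc \<longrightarrow> norm (cmod (deriv2 (test_fun j a) z)) \<le> norm (160 * s * (1 / cmod (1 - cnj a * z) ^ 3))"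
      using kb s by (auto simp: abs_mult intro: order_trans)
  qed
  show "in_B1 (test_fun j a)" using hol int by (simp add: in_B1_def)
  have "(LINT z:disc|lborel. cmod (deriv2 (test_fun j a) z)) \<le> (LINT z:disc|lborel. 160 * s * (1 / cmod (1 - cnj a * z) ^ 3))"
    by (rule set_integral_mono[OF int k kb])
  also have "\<dots> = 160 * (s * (LINT z:disc|lborel. 1 / cmod (1 - cnj a * z) ^ 3))"
    by (simp only: set_integral_mult_right mult.assoc)
  also have "\<dots> \<le> 160 * (54 * pi)"
    using kernel_integral(2)[OF a] by (intro mult_left_mono) (auto simp: s_def)
  \<comment> \<open>160 * 54 = 8640. The values at the origin add at most 1 + 4, well below
    10000.\<close>
  finally have "(LINT z:disc|lborel. cmod (deriv2 (test_fun j a) z)) / pi \<le> 8640"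
    by (simp add: field_simps)
  moreover have sj: "s ^ j \<le> 1" using s by (simp add: power_le_one)
  have "cmod (test_fun j a 0) \<le> 1"
    using higher_deriv_test_fun[OF a, of 0 0 j] s sj unfolding s' by (simp add: norm_power)
  moreover have "cmod (deriv (test_fun j a) 0) \<le> 4"
  proof -
    have "cmod (deriv (test_fun j a) 0) = real j * (cmod a * s ^ j)"
      using higher_deriv_test_fun[OF a, of 0 1 j] s unfolding s' by (simp add: norm_mult norm_power)
    also have "\<dots> \<le> 4 * (1 * 1)"
      using j a1 s sj by (intro mult_mono) auto
    finally show ?thesis by simp
  qed
  ultimately show "B1_norm (test_fun j a) \<le> 10000" by (simp add: B1_norm_def)
qed

subsection \<open>Weighted bounds for the coefficients\<close>

text \<open>Product and chain rule, sorted by the order of the derivative of \<open>f\<close>. The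
  second derivative displays the four coefficient functions, and the first is needed for its value
  at 0 in the norm.\<close>

lemma T_op_derivs:
  assumes u: "u holomorphic_on disc" and v: "v holomorphic_on disc" and \<phi>: "\<phi> holomorphic_on disc"
    and im: "\<phi> ` disc \<subseteq> disc" and f: "f holomorphic_on disc" and z: "z \<in> disc"
  shows "T_op u v \<phi> f holomorphic_on disc"
    and "deriv (T_op u v \<phi> f) z = deriv u z * f (\<phi> z) + (u z * deriv \<phi> z + deriv v z) * deriv f (\<phi> z)
      + v z * deriv \<phi> z * deriv2 f (\<phi> z)"
    and "deriv2 (T_op u v \<phi> f) z = deriv2 u z * f (\<phi> z)
      + (2 * deriv u z * deriv \<phi> z + u z * deriv2 \<phi> z + deriv2 v z) * deriv f (\<phi> z)
      + (u z * (deriv \<phi> z)\<^sup>2 + 2 * deriv v z * deriv \<phi> z + v z * deriv2 \<phi> z) * deriv2 f (\<phi> z)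
      + v z * (deriv \<phi> z)\<^sup>2 * deriv (deriv2 f) (\<phi> z)"
proof -
  let ?E = "\<lambda>z. deriv u z * f (\<phi> z) + (u z * deriv \<phi> z + deriv v z) * deriv f (\<phi> z) + v z * deriv \<phi> z * deriv2 f (\<phi> z)"
  have d: "(g has_field_derivative deriv g w) (at w)" if "g holomorphic_on disc" "w \<in> disc" for g w
    using holomorphic_derivI[OF that(1) open_ball that(2)] .
  have dc: "((\<lambda>x. g (\<phi> x)) has_field_derivative deriv g (\<phi> w) * deriv \<phi> w) (at w)"
    if "g holomorphic_on disc" "w \<in> disc" for g w
    using im that by (intro DERIV_chain2[OF d d[OF \<phi>]]) blast+
  note hol = u v \<phi> f u[THEN holomorphic_deriv] v[THEN holomorphic_deriv] \<phi>[THEN holomorphic_deriv]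
    f[THEN holomorphic_deriv] f[THEN holomorphic_deriv, THEN holomorphic_deriv]
  have E: "(T_op u v \<phi> f has_field_derivative ?E w) (at w)" if "w \<in> disc" for w
    unfolding T_op_def
    by (rule derivative_eq_intros d dc hol open_ball that refl)+ (simp add: algebra_simps)
  then show "T_op u v \<phi> f holomorphic_on disc"
    unfolding holomorphic_on_open[OF open_ball] by blast
  show "deriv (T_op u v \<phi> f) z = ?E z"
    using E[OF z] by (rule DERIV_imp_deriv)
  have "(?E has_field_derivative deriv2 u z * f (\<phi> z)
      + (2 * deriv u z * deriv \<phi> z + u z * deriv2 \<phi> z + deriv2 v z) * deriv f (\<phi> z)
      + (u z * (deriv \<phi> z)\<^sup>2 + 2 * deriv v z * deriv \<phi> z + v z * deriv2 \<phi> z) * deriv2 f (\<phi> z)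
      + v z * (deriv \<phi> z)\<^sup>2 * deriv (deriv2 f) (\<phi> z)) (at z)"
    by (rule derivative_eq_intros d dc hol open_ball z refl)+ (simp add: algebra_simps power2_eq_square)
  then have "(deriv (T_op u v \<phi> f) has_field_derivative deriv2 u z * f (\<phi> z)
      + (2 * deriv u z * deriv \<phi> z + u z * deriv2 \<phi> z + deriv2 v z) * deriv f (\<phi> z)
      + (u z * (deriv \<phi> z)\<^sup>2 + 2 * deriv v z * deriv \<phi> z + v z * deriv2 \<phi> z) * deriv2 f (\<phi> z)
      + v z * (deriv \<phi> z)\<^sup>2 * deriv (deriv2 f) (\<phi> z)) (at z)"
    by (rule has_field_derivative_transform_within_open[OF _ open_ball z]) (simp add: DERIV_imp_deriv[OF E])
  then show "deriv2 (T_op u v \<phi> f) z = deriv2 u z * f (\<phi> z)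
      + (2 * deriv u z * deriv \<phi> z + u z * deriv2 \<phi> z + deriv2 v z) * deriv f (\<phi> z)
      + (u z * (deriv \<phi> z)\<^sup>2 + 2 * deriv v z * deriv \<phi> z + v z * deriv2 \<phi> z) * deriv2 f (\<phi> z)
      + v z * (deriv \<phi> z)\<^sup>2 * deriv (deriv2 f) (\<phi> z)"
    by (rule DERIV_imp_deriv)
qed

section \<open>Closure properties of functions bounded against the weight\<close>

definition weighted_bounded :: "real \<Rightarrow> (complex \<Rightarrow> complex) \<Rightarrow> bool" where
  "weighted_bounded \<alpha> g \<longleftrightarrow> (\<exists>M. \<forall>z\<in>disc. (1 - (cmod z)\<^sup>2) powr \<alpha> * cmod (g z) \<le> M)"

lemma weighted_boundedI:
  "(\<And>z. z \<in> disc \<Longrightarrow> (1 - (cmod z)\<^sup>2) powr \<alpha> * cmod (g z) \<le> M) \<Longrightarrow> weighted_bounded \<alpha> g"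
  unfolding weighted_bounded_def by blast

lemma weighted_bounded_cong:
  "weighted_bounded \<alpha> g \<Longrightarrow> (\<And>z. z \<in> disc \<Longrightarrow> g z = h z) \<Longrightarrow> weighted_bounded \<alpha> h"
  by (auto simp: weighted_bounded_def)

lemma weighted_bounded_dominated:
  assumes "weighted_bounded \<alpha> g" "weighted_bounded \<alpha> h"
    and le: "\<And>z. z \<in> disc \<Longrightarrow> cmod (k z) \<le> C * (cmod (g z) + cmod (h z))" and C: "0 \<le> C"
  shows "weighted_bounded \<alpha> k"
proof -
  obtain M N where M: "\<And>z. z \<in> disc \<Longrightarrow> (1 - (cmod z)\<^sup>2) powr \<alpha> * cmod (g z) \<le> M"
    and N: "\<And>z. z \<in> disc \<Longrightarrow> (1 - (cmod z)\<^sup>2) powr \<alpha> * cmod (h z) \<le> N"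
    using assms unfolding weighted_bounded_def by blast
  show ?thesis
  proof (rule weighted_boundedI[where M = "C * (M + N)"])
    fix z :: complex assume z: "z \<in> disc"
    have "(1 - (cmod z)\<^sup>2) powr \<alpha> * cmod (k z) \<le> (1 - (cmod z)\<^sup>2) powr \<alpha> * (C * (cmod (g z) + cmod (h z)))"
      using le[OF z] by (intro mult_left_mono) auto
    also have "\<dots> = C * ((1 - (cmod z)\<^sup>2) powr \<alpha> * cmod (g z) + (1 - (cmod z)\<^sup>2) powr \<alpha> * cmod (h z))"
      by (simp add: algebra_simps)
    also have "\<dots> \<le> C * (M + N)"
      using M[OF z] N[OF z] C by (intro mult_left_mono add_mono)
    finally show "(1 - (cmod z)\<^sup>2) powr \<alpha> * cmod (k z) \<le> C * (M + N)" .
  qed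
qed

lemma weighted_bounded_add:
  "weighted_bounded \<alpha> g \<Longrightarrow> weighted_bounded \<alpha> h \<Longrightarrow> weighted_bounded \<alpha> (\<lambda>z. g z + h z)"
  by (rule weighted_bounded_dominated[where C = 1 and g = g and h = h]) (auto intro: norm_triangle_ineq)

lemma weighted_bounded_diff:
  "weighted_bounded \<alpha> g \<Longrightarrow> weighted_bounded \<alpha> h \<Longrightarrow> weighted_bounded \<alpha> (\<lambda>z. g z - h z)"
  by (rule weighted_bounded_dominated[where C = 1 and g = g and h = h]) (auto intro: norm_triangle_ineq4)

lemma weighted_bounded_mult:
  assumes "weighted_bounded \<alpha> g" "\<And>z. z \<in> disc \<Longrightarrow> cmod (m z) \<le> C" "0 \<le> C"
  shows "weighted_bounded \<alpha> (\<lambda>z. m z * g z)"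
proof (rule weighted_bounded_dominated[OF assms(1,1)])
  fix z :: complex assume "z \<in> disc"
  then have "cmod (m z) * cmod (g z) \<le> C * cmod (g z)"
    using assms(2) by (intro mult_right_mono) auto
  also have "\<dots> \<le> C * (cmod (g z) + cmod (g z))"
    using assms(3) by (intro mult_left_mono) auto
  finally show "cmod (m z * g z) \<le> C * (cmod (g z) + cmod (g z))" by (simp add: norm_mult)
qed fact

lemma weighted_bounded_cmult:
  "weighted_bounded \<alpha> g \<Longrightarrow> weighted_bounded \<alpha> (\<lambda>z. c * g z)"
  by (rule weighted_bounded_mult[where C = "cmod c"]) auto

text \<open>Both moduli are nonnegative, so the paired suprema of (ii) and (iii) split into
  conditions on single functions, to which linear combinations can be applied.\<close>

lemma weighted_bounded_pair:
  "(\<exists>M. \<forall>z\<in>disc. (1 - (cmod z)\<^sup>2) powr \<alpha> * (cmod (g z) + cmod (h z)) \<le> M)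
    \<longleftrightarrow> weighted_bounded \<alpha> g \<and> weighted_bounded \<alpha> h" (is "(\<exists>M. ?P M) \<longleftrightarrow> _")
proof
  assume "\<exists>M. ?P M"
  then obtain M where M: "?P M" by blast
  have "(1 - (cmod z)\<^sup>2) powr \<alpha> * cmod (g z) \<le> (1 - (cmod z)\<^sup>2) powr \<alpha> * (cmod (g z) + cmod (h z))"
    "(1 - (cmod z)\<^sup>2) powr \<alpha> * cmod (h z) \<le> (1 - (cmod z)\<^sup>2) powr \<alpha> * (cmod (g z) + cmod (h z))" for z
    by (intro mult_left_mono; simp)+
  with M show "weighted_bounded \<alpha> g \<and> weighted_bounded \<alpha> h"
    by (meson order_trans weighted_boundedI)
next
  assume "weighted_bounded \<alpha> g \<and> weighted_bounded \<alpha> h"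
  then obtain M N where "\<forall>z\<in>disc. (1 - (cmod z)\<^sup>2) powr \<alpha> * cmod (g z) \<le> M"
    "\<forall>z\<in>disc. (1 - (cmod z)\<^sup>2) powr \<alpha> * cmod (h z) \<le> N"
    by (auto simp: weighted_bounded_def)
  then have "?P (M + N)" by (simp add: distrib_left add_mono)
  then show "\<exists>M. ?P M" by blast
qed

lemma weighted_le_Zalpha_norm:
  assumes "in_Zalpha \<alpha> f" "z \<in> disc"
  shows "(1 - (cmod z)\<^sup>2) powr \<alpha> * cmod (deriv2 f z) \<le> Zalpha_norm \<alpha> f"
proof -
  have "(1 - (cmod z)\<^sup>2) powr \<alpha> * cmod (deriv2 f z) \<le> (SUP z\<in>disc. (1 - (cmod z)\<^sup>2) powr \<alpha> * cmod (deriv2 f z))"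
    using assms by (intro cSUP_upper) (auto simp: in_Zalpha_def)
  then show ?thesis
    using norm_ge_zero[of "f 0"] norm_ge_zero[of "deriv f 0"] unfolding Zalpha_norm_def by linarith
qed

section \<open>Coefficient bounds from monomials\<close>

lemma weighted_bounded_test:
  assumes u: "u holomorphic_on disc" and v: "v holomorphic_on disc" and \<phi>: "\<phi> holomorphic_on disc"
    and im: "\<phi> ` disc \<subseteq> disc" and f: "f holomorphic_on disc" and Z: "in_Zalpha \<alpha> (T_op u v \<phi> f)"
  shows "weighted_bounded \<alpha> (\<lambda>z. deriv2 u z * f (\<phi> z)
      + (2 * deriv u z * deriv \<phi> z + u z * deriv2 \<phi> z + deriv2 v z) * deriv f (\<phi> z)
      + (u z * (deriv \<phi> z)\<^sup>2 + 2 * deriv v z * deriv \<phi> z + v z * deriv2 \<phi> z) * deriv2 f (\<phi> z)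
      + v z * (deriv \<phi> z)\<^sup>2 * deriv (deriv2 f) (\<phi> z))"
  by (rule weighted_bounded_cong[where g = "deriv2 (T_op u v \<phi> f)"])
     (auto intro: weighted_boundedI weighted_le_Zalpha_norm[OF Z] T_op_derivs(3)[OF u v \<phi> im f])

text \<open>At \<open>k = 0\<close> the truncated exponent is harmless, as the factor
  \<open>of_nat k\<close> vanishes.\<close>

lemma deriv_cmult_power: "deriv (\<lambda>z::complex. c * z ^ k) = (\<lambda>z. c * of_nat k * z ^ (k - 1))"
  by (rule ext, rule DERIV_imp_deriv) (auto intro!: derivative_eq_intros)

text \<open>The factor \<open>1\<close> makes \<open>deriv_cmult_power\<close> applicable as a rewrite rule at every order.\<close>

lemma power_in_B1: "in_B1 (\<lambda>z. 1 * z ^ k)"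
proof -
  have "set_integrable lborel (cball 0 1) (\<lambda>z. cmod (deriv2 (\<lambda>z. 1 * z ^ k) z))"
    unfolding set_integrable_def deriv_cmult_power
    by (intro borel_integrable_compact continuous_intros compact_cball)
  then have "set_integrable lborel disc (\<lambda>z. cmod (deriv2 (\<lambda>z. 1 * z ^ k) z))"
    by (rule set_integrable_subset) auto
  then show ?thesis by (simp add: in_B1_def holomorphic_intros)
qed

text \<open>The monomials of degree 0 to 3 give a triangular system: \<open>A\<close>,
  \<open>A \<phi> + B\<close>, \<open>A \<phi>^2 + 2 B \<phi> + 2 C\<close> and
  \<open>A \<phi>^3 + 3 B \<phi>^2 + 6 C \<phi> + 6 D\<close> are weighted bounded. It is solved in
  this order, multiplication by powers of \<open>\<phi>\<close> being harmless because
  \<open>|\<phi>| < 1\<close>.\<close>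

lemma weighted_bounded_coefficients:
  assumes u: "u holomorphic_on disc" and v: "v holomorphic_on disc" and \<phi>: "\<phi> holomorphic_on disc"
    and im: "\<phi> ` disc \<subseteq> disc" and T: "bounded_B1_Zalpha \<alpha> (T_op u v \<phi>)"
  shows "weighted_bounded \<alpha> (deriv2 u)"
    and "weighted_bounded \<alpha> (\<lambda>z. 2 * deriv u z * deriv \<phi> z + u z * deriv2 \<phi> z + deriv2 v z)"
    and "weighted_bounded \<alpha> (\<lambda>z. u z * (deriv \<phi> z)\<^sup>2 + 2 * deriv v z * deriv \<phi> z + v z * deriv2 \<phi> z)"
    and "weighted_bounded \<alpha> (\<lambda>z. v z * (deriv \<phi> z)\<^sup>2)"
proof -
  let ?A = "deriv2 u"
  define B where "B = (\<lambda>z. 2 * deriv u z * deriv \<phi> z + u z * deriv2 \<phi> z + deriv2 v z)"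
  define C where "C = (\<lambda>z. u z * (deriv \<phi> z)\<^sup>2 + 2 * deriv v z * deriv \<phi> z + v z * deriv2 \<phi> z)"
  define D where "D = (\<lambda>z. v z * (deriv \<phi> z)\<^sup>2)"
  have "in_Zalpha \<alpha> (T_op u v \<phi> (\<lambda>z. 1 * z ^ k))" for k
    using T power_in_B1 unfolding bounded_B1_Zalpha_def by blast
  from weighted_bounded_test[OF u v \<phi> im _ this]
  have test': "weighted_bounded \<alpha> (\<lambda>z. ?A z * (1 * \<phi> z ^ k) + B z * deriv (\<lambda>z. 1 * z ^ k) (\<phi> z)
     + C z * deriv2 (\<lambda>z. 1 * z ^ k) (\<phi> z) + D z * deriv (deriv2 (\<lambda>z. 1 * z ^ k)) (\<phi> z))" for k
    by (simp add: B_def C_def D_def holomorphic_intros)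
  note test = test'[unfolded deriv_cmult_power]
  have m: "weighted_bounded \<alpha> (\<lambda>z. \<phi> z ^ k * g z)" if "weighted_bounded \<alpha> g" for k g
  proof (rule weighted_bounded_mult[OF that, where C = 1])
    fix z :: complex assume "z \<in> disc"
    with im have "\<phi> z \<in> disc" by blast
    then show "cmod (\<phi> z ^ k) \<le> 1" by (simp add: norm_power power_le_one)
  qed simp
  show A': "weighted_bounded \<alpha> ?A"
    using test[of 0] by simp
  have B': "weighted_bounded \<alpha> B"
    by (rule weighted_bounded_cong[OF weighted_bounded_diff[OF test[of 1] m[OF A', of 1]]])
       (simp add: algebra_simps)
  have C': "weighted_bounded \<alpha> C"
    by (rule weighted_bounded_cong[OF weighted_bounded_cmult[OF weighted_bounded_diff[OF weighted_bounded_diff[OF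
          test[of 2] m[OF A', of 2]] m[OF weighted_bounded_cmult[OF B', of 2], of 1]], of "1/2"]])
       (simp add: algebra_simps)
  have D': "weighted_bounded \<alpha> D"
    by (rule weighted_bounded_cong[OF weighted_bounded_cmult[OF weighted_bounded_diff[OF weighted_bounded_diff[OF weighted_bounded_diff[OF
          test[of 3] m[OF A', of 3]] m[OF weighted_bounded_cmult[OF B', of 3], of 2]] m[OF weighted_bounded_cmult[OF C', of 6], of 1]], of "1/6"]])
       (simp add: algebra_simps)
  show "weighted_bounded \<alpha> (\<lambda>z. 2 * deriv u z * deriv \<phi> z + u z * deriv2 \<phi> z + deriv2 v z)"
    and "weighted_bounded \<alpha> (\<lambda>z. u z * (deriv \<phi> z)\<^sup>2 + 2 * deriv v z * deriv \<phi> z + v z * deriv2 \<phi> z)"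
    and "weighted_bounded \<alpha> (\<lambda>z. v z * (deriv \<phi> z)\<^sup>2)"
    using B' C' D' by (simp_all add: B_def C_def D_def)
qed

section \<open>From test functions to the growth conditions\<close>

lemma weighted_bounded_divide:
  assumes im: "\<phi> ` disc \<subseteq> disc" and X: "weighted_bounded \<alpha> X"
    and Y: "weighted_bounded \<alpha> (\<lambda>z. X z * (cnj (\<phi> z) / of_real (1 - (cmod (\<phi> z))\<^sup>2)) ^ n)"
  shows "weighted_bounded \<alpha> (\<lambda>z. X z / of_real (1 - (cmod (\<phi> z))\<^sup>2) ^ n)"
proof (rule weighted_bounded_dominated[OF X Y])
  fix z :: complex assume "z \<in> disc"
  with im have "\<phi> z \<in> disc" by blast
  then have w: "cmod (\<phi> z) < 1" by simp
  define p where "p = 1 - (cmod (\<phi> z))\<^sup>2"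
  have p: "0 < p" using w by (simp add: p_def abs_square_less_1)
  \<comment> \<open>The numerator \<open>cnj (\<phi> z)\<close> in \<open>Y\<close> may vanish. For
    \<open>|\<phi> z| \<le> 1/2\<close> the reciprocal \<open>1 / p\<close> is at most 2 and
    \<open>X\<close> alone suffices; otherwise the numerator costs only a factor 2.\<close>
  have "1 / p \<le> 2 * max 1 (cmod (\<phi> z) / p)"
  proof (cases "cmod (\<phi> z) \<le> 1/2")
    case True
    then have "(cmod (\<phi> z))\<^sup>2 \<le> (1/2)\<^sup>2" by (intro power_mono) auto
    then have "1 \<le> 2 * p" by (simp add: p_def power2_eq_square)
    then have "1 / p \<le> 2 * 1" using p by (simp add: field_simps)
    then show ?thesis by simp
  next
    case False
    then have "1 / p \<le> 2 * (cmod (\<phi> z) / p)" using p by (simp add: field_simps)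
    then show ?thesis by simp
  qed
  then have "(1 / p) ^ n \<le> (2 * max 1 (cmod (\<phi> z) / p)) ^ n"
    using p by (intro power_mono) auto
  also have "\<dots> \<le> 2 ^ n * (1 + (cmod (\<phi> z) / p) ^ n)"
    using p by (simp add: power_mult_distrib max_def)
  finally have "cmod (X z) * (1 / p) ^ n \<le> cmod (X z) * (2 ^ n * (1 + (cmod (\<phi> z) / p) ^ n))"
    by (intro mult_left_mono) auto
  then show "cmod (X z / of_real (1 - (cmod (\<phi> z))\<^sup>2) ^ n)
     \<le> 2 ^ n * (cmod (X z) + cmod (X z * (cnj (\<phi> z) / of_real (1 - (cmod (\<phi> z))\<^sup>2)) ^ n))"
    unfolding p_def[symmetric] using p
    by (simp add: norm_mult norm_divide norm_power power_one_over power_divide algebra_simps)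
qed simp

text \<open>On the diagonal the denominator \<open>1 - cnj a * a\<close> equals
  \<open>1 - |a|^2\<close>, so the numerator cancels all but \<open>n\<close> of its powers.\<close>

lemma test_fun_diagonal:
  assumes "a \<in> disc"
  shows "(deriv ^^ n) (test_fun j a) a
    = of_nat (pochhammer j n) * (cnj a / of_real (1 - (cmod a)\<^sup>2)) ^ n"
proof -
  have "1 - cnj a * a = of_real (1 - (cmod a)\<^sup>2)"
    by (simp add: complex_norm_square[symmetric] mult.commute[of "cnj a"] del: of_real_power)
  moreover have "complex_of_real (1 - (cmod a)\<^sup>2) \<noteq> 0"
    unfolding of_real_eq_0_iff using assms abs_square_less_1[of "cmod a"] by simp
  ultimately show ?thesis
    unfolding higher_deriv_test_fun[OF assms assms] by (simp add: power_divide power_add)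
qed

text \<open>The test bounds are uniform in \<open>a\<close>, so \<open>a = \<phi> z\<close> may
  depend on \<open>z\<close>. The resulting functions \<open>E j\<close> are cubic polynomials in
  \<open>j\<close>, with coefficients built from \<open>A\<close>, \<open>b\<close>,
  \<open>c\<close>, \<open>d\<close>, and finite differences in \<open>j\<close> isolate the
  unknowns.\<close>

lemma weighted_bounded_necessary:
  assumes u: "u holomorphic_on disc" and v: "v holomorphic_on disc" and \<phi>: "\<phi> holomorphic_on disc"
    and im: "\<phi> ` disc \<subseteq> disc"
    and test: "\<forall>j\<in>{1..4}. \<exists>M. \<forall>a\<in>disc. in_Zalpha \<alpha> (T_op u v \<phi> (test_fun j a)) \<and>
                         Zalpha_norm \<alpha> (T_op u v \<phi> (test_fun j a)) \<le> M"
    and A: "weighted_bounded \<alpha> (deriv2 u)"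
    and B: "weighted_bounded \<alpha> (\<lambda>z. 2 * deriv u z * deriv \<phi> z + u z * deriv2 \<phi> z + deriv2 v z)"
    and C: "weighted_bounded \<alpha> (\<lambda>z. u z * (deriv \<phi> z)\<^sup>2 + 2 * deriv v z * deriv \<phi> z + v z * deriv2 \<phi> z)"
    and D: "weighted_bounded \<alpha> (\<lambda>z. v z * (deriv \<phi> z)\<^sup>2)"
  shows "weighted_bounded \<alpha> (\<lambda>z. (2 * deriv u z * deriv \<phi> z + u z * deriv2 \<phi> z + deriv2 v z)
      / of_real (1 - (cmod (\<phi> z))\<^sup>2) ^ 1)"
    and "weighted_bounded \<alpha> (\<lambda>z. (u z * (deriv \<phi> z)\<^sup>2 + 2 * deriv v z * deriv \<phi> z + v z * deriv2 \<phi> z)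
      / of_real (1 - (cmod (\<phi> z))\<^sup>2) ^ 2)"
    and "weighted_bounded \<alpha> (\<lambda>z. (v z * (deriv \<phi> z)\<^sup>2) / of_real (1 - (cmod (\<phi> z))\<^sup>2) ^ 3)"
proof -
  define q where "q z = cnj (\<phi> z) / of_real (1 - (cmod (\<phi> z))\<^sup>2)" for z
  define b where "b z = (2 * deriv u z * deriv \<phi> z + u z * deriv2 \<phi> z + deriv2 v z) * q z ^ 1" for z
  define c where "c z = (u z * (deriv \<phi> z)\<^sup>2 + 2 * deriv v z * deriv \<phi> z + v z * deriv2 \<phi> z) * q z ^ 2" for z
  define d where "d z = v z * (deriv \<phi> z)\<^sup>2 * q z ^ 3" for z
  define E where "E j z = deriv2 u z + of_nat (pochhammer j 1) * b z + of_nat (pochhammer j 2) * c z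
    + of_nat (pochhammer j 3) * d z" for j z
  have E: "weighted_bounded \<alpha> (E j)" if j: "j \<in> {1..4}" for j
  proof -
    from test j obtain M where M: "\<And>a. a \<in> disc \<Longrightarrow> in_Zalpha \<alpha> (T_op u v \<phi> (test_fun j a)) \<and>
                         Zalpha_norm \<alpha> (T_op u v \<phi> (test_fun j a)) \<le> M" by blast
    show ?thesis
    proof (rule weighted_boundedI)
      fix z :: complex assume z: "z \<in> disc"
      with im have w: "\<phi> z \<in> disc" by blast
      have diag: "test_fun j (\<phi> z) (\<phi> z) = 1"
        "deriv (test_fun j (\<phi> z)) (\<phi> z) = of_nat (pochhammer j 1) * q z ^ 1"
        "deriv2 (test_fun j (\<phi> z)) (\<phi> z) = of_nat (pochhammer j 2) * q z ^ 2"
        "deriv (deriv2 (test_fun j (\<phi> z))) (\<phi> z) = of_nat (pochhammer j 3) * q z ^ 3"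
        using test_fun_diagonal[OF w, of 0 j] test_fun_diagonal[OF w, of 1 j]
          test_fun_diagonal[OF w, of 2 j] test_fun_diagonal[OF w, of 3 j]
        unfolding q_def[of z, symmetric] by (simp_all add: numeral_2_eq_2 numeral_3_eq_3)
      have "E j z = deriv2 (T_op u v \<phi> (test_fun j (\<phi> z))) z"
        unfolding T_op_derivs(3)[OF u v \<phi> im test_fun_holomorphic[OF w] z] diag
        by (simp add: E_def b_def c_def d_def)
      then show "(1 - (cmod z)\<^sup>2) powr \<alpha> * cmod (E j z) \<le> M"
        using weighted_le_Zalpha_norm[OF _ z] M[OF w] by fastforce
    qed
  qed
  have E1: "E 1 z = deriv2 u z + b z + 2 * c z + 6 * d z"
    and E2: "E 2 z = deriv2 u z + 2 * b z + 6 * c z + 24 * d z"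
    and E3: "E 3 z = deriv2 u z + 3 * b z + 12 * c z + 60 * d z"
    and E4: "E 4 z = deriv2 u z + 4 * b z + 20 * c z + 120 * d z" for z
    by (simp_all add: E_def numeral_eq_Suc pochhammer_Suc)
  note intros = weighted_bounded_add weighted_bounded_diff weighted_bounded_cmult
  \<comment> \<open>The third difference kills everything of degree below 3 in \<open>j\<close> and
    leaves \<open>6 * d\<close>.\<close>
  have "weighted_bounded \<alpha> (\<lambda>z. 1/6 * (E 4 z - 3 * E 3 z + 3 * E 2 z - E 1 z))"
    by (intro intros E) auto
  then have d: "weighted_bounded \<alpha> d"
    by (rule weighted_bounded_cong) (simp add: E1[simplified] E2 E3 E4 algebra_simps)
  \<comment> \<open>The second difference is \<open>2 * c + 18 * d\<close>.\<close>
  have "weighted_bounded \<alpha> (\<lambda>z. 1/2 * (E 3 z - 2 * E 2 z + E 1 z - 18 * d z))"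
    by (intro intros E d) auto
  then have c: "weighted_bounded \<alpha> c"
    by (rule weighted_bounded_cong) (simp add: E1[simplified] E2 E3 E4 algebra_simps)
  have "weighted_bounded \<alpha> (\<lambda>z. E 1 z - deriv2 u z - 2 * c z - 6 * d z)"
    by (intro weighted_bounded_diff weighted_bounded_cmult E c d A) auto
  then have b: "weighted_bounded \<alpha> b"
    by (rule weighted_bounded_cong) (simp add: E1[simplified])
  show "weighted_bounded \<alpha> (\<lambda>z. (2 * deriv u z * deriv \<phi> z + u z * deriv2 \<phi> z + deriv2 v z)
      / of_real (1 - (cmod (\<phi> z))\<^sup>2) ^ 1)"
    using b by (intro weighted_bounded_divide[OF im B]) (simp add: b_def[abs_def] q_def)
  show "weighted_bounded \<alpha> (\<lambda>z. (u z * (deriv \<phi> z)\<^sup>2 + 2 * deriv v z * deriv \<phi> z + v z * deriv2 \<phi> z)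
      / of_real (1 - (cmod (\<phi> z))\<^sup>2) ^ 2)"
    using c by (intro weighted_bounded_divide[OF im C]) (simp add: c_def[abs_def] q_def)
  show "weighted_bounded \<alpha> (\<lambda>z. (v z * (deriv \<phi> z)\<^sup>2) / of_real (1 - (cmod (\<phi> z))\<^sup>2) ^ 3)"
    using d by (intro weighted_bounded_divide[OF im D]) (simp add: d_def[abs_def] q_def)
qed

section \<open>Sufficiency of the growth conditions\<close>

lemma bounded_T_op:
  assumes u: "u holomorphic_on disc" and v: "v holomorphic_on disc" and \<phi>: "\<phi> holomorphic_on disc"
    and im: "\<phi> ` disc \<subseteq> disc"
    and M1: "\<forall>z\<in>disc. (1 - (cmod z)\<^sup>2) powr \<alpha> * (cmod (deriv2 u z) +
             cmod (2 * deriv u z * deriv \<phi> z + u z * deriv2 \<phi> z + deriv2 v z) / (1 - (cmod (\<phi> z))\<^sup>2)) \<le> M1"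
    and M2: "\<forall>z\<in>disc. (1 - (cmod z)\<^sup>2) powr \<alpha> *
            (cmod (u z * (deriv \<phi> z)\<^sup>2 + 2 * deriv v z * deriv \<phi> z + v z * deriv2 \<phi> z) / (1 - (cmod (\<phi> z))\<^sup>2)\<^sup>2 +
             cmod (v z * (deriv \<phi> z)\<^sup>2) / (1 - (cmod (\<phi> z))\<^sup>2) ^ 3) \<le> M2"
  shows "bounded_B1_Zalpha \<alpha> (T_op u v \<phi>)"
proof -
  \<comment> \<open>This is 3! * 4^3 * 50000, the largest constant of
    \<open>B1_higher_deriv_bound\<close> among the orders 0 to 3.\<close>
  define K :: real where "K = 19200000"
  define q where "q = 1 - (cmod (\<phi> 0))\<^sup>2"
  \<comment> \<open>\<open>L\<close> collects the coefficients in the bounds for \<open>T f\<close>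
    and its derivative at 0, with one power of \<open>1 / q\<close> per derivative of
    \<open>f\<close>.\<close>
  define L where "L = cmod (u 0) + cmod (v 0) / q
    + (cmod (deriv u 0) + cmod (u 0 * deriv \<phi> 0 + deriv v 0) / q + cmod (v 0 * deriv \<phi> 0) / q ^ 2)"
  have "in_Zalpha \<alpha> (T_op u v \<phi> f) \<and> Zalpha_norm \<alpha> (T_op u v \<phi> f) \<le> (L + (M1 + M2)) * K * B1_norm f"
    if f: "in_B1 f" for f
  proof -
    define N where "N = K * B1_norm f"
    have N: "0 \<le> N" using B1_norm_nonneg[of f] by (simp add: N_def K_def)
    have hol: "f holomorphic_on disc" using f by (simp add: in_B1_def)
    have pt: "cmod ((deriv ^^ n) f w) \<le> N / (1 - (cmod w)\<^sup>2) ^ n" if "n \<le> 3" "w \<in> disc" for n w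
    proof -
      have "fact n * 4 ^ n * 50000 \<le> (fact 3 * 4 ^ 3 * 50000 :: real)"
        using that by (intro mult_mono fact_mono power_increasing) auto
      also have "\<dots> = K" by (simp add: K_def fact_numeral)
      finally have "fact n * 4 ^ n * 50000 * B1_norm f \<le> N"
        unfolding N_def using B1_norm_nonneg by (rule mult_right_mono)
      moreover have "0 < 1 - (cmod w)\<^sup>2" using that by (simp add: abs_square_less_1)
      ultimately show ?thesis
        using B1_higher_deriv_bound[OF f that(2), of n] by (simp add: pos_le_divide_eq)
    qed
    have pt': "cmod (f w) \<le> N" "cmod (deriv f w) \<le> N / (1 - (cmod w)\<^sup>2)"
      "cmod (deriv2 f w) \<le> N / (1 - (cmod w)\<^sup>2) ^ 2" "cmod (deriv (deriv2 f) w) \<le> N / (1 - (cmod w)\<^sup>2) ^ 3"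
      if "w \<in> disc" for w
      using pt[of 0, OF _ that] pt[of 1, OF _ that] pt[of 2, OF _ that] pt[of 3, OF _ that]
      by (simp_all add: numeral_2_eq_2 numeral_3_eq_3)
    have mult: "cmod (c * d) \<le> cmod c * D" if "cmod d \<le> D" for c d D
      unfolding norm_mult using that by (rule mult_left_mono) simp
    have bound: "(1 - (cmod z)\<^sup>2) powr \<alpha> * cmod (deriv2 (T_op u v \<phi> f) z) \<le> (M1 + M2) * N" if z: "z \<in> disc" for z
    proof -
      have w: "\<phi> z \<in> disc" using im z by blast
      define p where "p = 1 - (cmod (\<phi> z))\<^sup>2"
      let ?W = "(1 - (cmod z)\<^sup>2) powr \<alpha>" and ?A = "deriv2 u z"
        and ?B = "2 * deriv u z * deriv \<phi> z + u z * deriv2 \<phi> z + deriv2 v z"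
        and ?C = "u z * (deriv \<phi> z)\<^sup>2 + 2 * deriv v z * deriv \<phi> z + v z * deriv2 \<phi> z"
        and ?D = "v z * (deriv \<phi> z)\<^sup>2"
      have "cmod (deriv2 (T_op u v \<phi> f) z) \<le> cmod (?A * f (\<phi> z)) + cmod (?B * deriv f (\<phi> z))
          + cmod (?C * deriv2 f (\<phi> z)) + cmod (?D * deriv (deriv2 f) (\<phi> z))"
        unfolding T_op_derivs(3)[OF u v \<phi> im hol z]
        by (intro order_trans[OF norm_triangle_ineq] add_mono order_refl)
      also have "\<dots> \<le> cmod ?A * N + cmod ?B * (N / p) + cmod ?C * (N / p ^ 2) + cmod ?D * (N / p ^ 3)"
        unfolding p_def by (intro add_mono mult pt' w)
      finally have "?W * cmod (deriv2 (T_op u v \<phi> f) z)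
          \<le> ?W * (cmod ?A * N + cmod ?B * (N / p) + cmod ?C * (N / p ^ 2) + cmod ?D * (N / p ^ 3))"
        by (rule mult_left_mono) simp
      \<comment> \<open>The powers of \<open>p\<close> in the derivative bounds are exactly the
        denominators of (iii).\<close>
      also have "\<dots> = (?W * (cmod ?A + cmod ?B / p) + ?W * (cmod ?C / p ^ 2 + cmod ?D / p ^ 3)) * N"
        by (simp add: algebra_simps)
      also have "\<dots> \<le> (M1 + M2) * N"
        using M1 M2 z N unfolding p_def by (intro mult_right_mono add_mono) auto
      finally show ?thesis .
    qed
    have w: "\<phi> 0 \<in> disc" using im centre_in_ball[of 0 "1::real"] zero_less_one by blast
    have "cmod (T_op u v \<phi> f 0) \<le> cmod (u 0 * f (\<phi> 0)) + cmod (v 0 * deriv f (\<phi> 0))"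
      unfolding T_op_def by (rule norm_triangle_ineq)
    also have "\<dots> \<le> cmod (u 0) * N + cmod (v 0) * (N / q)"
      unfolding q_def by (intro add_mono mult pt' w)
    finally have F0: "cmod (T_op u v \<phi> f 0) \<le> cmod (u 0) * N + cmod (v 0) * (N / q)" .
    have "cmod (deriv (T_op u v \<phi> f) 0) \<le> cmod (deriv u 0 * f (\<phi> 0))
        + cmod ((u 0 * deriv \<phi> 0 + deriv v 0) * deriv f (\<phi> 0)) + cmod (v 0 * deriv \<phi> 0 * deriv2 f (\<phi> 0))"
      by (subst T_op_derivs(2)[OF u v \<phi> im hol])
         (auto intro!: order_trans[OF norm_triangle_ineq] add_mono order_refl)
    also have "\<dots> \<le> cmod (deriv u 0) * N + cmod (u 0 * deriv \<phi> 0 + deriv v 0) * (N / q) + cmod (v 0 * deriv \<phi> 0) * (N / q ^ 2)"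
      unfolding q_def by (intro add_mono mult pt' w)
    finally have F1: "cmod (deriv (T_op u v \<phi> f) 0) \<le> \<dots>" .
    have "(SUP z\<in>disc. (1 - (cmod z)\<^sup>2) powr \<alpha> * cmod (deriv2 (T_op u v \<phi> f) z)) \<le> (M1 + M2) * N"
      by (rule cSUP_least) (use bound in auto)
    with F0 F1 have "Zalpha_norm \<alpha> (T_op u v \<phi> f) \<le> L * N + (M1 + M2) * N"
      unfolding Zalpha_norm_def L_def by (simp add: algebra_simps)
    moreover have "in_Zalpha \<alpha> (T_op u v \<phi> f)"
      unfolding in_Zalpha_def bdd_above_def
      using T_op_derivs(1)[OF u v \<phi> im hol, of 0] bound by (auto intro!: exI[of _ "(M1 + M2) * N"])
    ultimately show ?thesis by (simp add: N_def algebra_simps)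
  qed
  then show ?thesis unfolding bounded_B1_Zalpha_def by blast
qed

theorem theorem2p7:
  fixes \<alpha> :: real and u v \<phi> :: "complex \<Rightarrow> complex"
  assumes "\<alpha> > 0"
    and "u holomorphic_on disc" and "v holomorphic_on disc" and "\<phi> holomorphic_on disc"
    and "\<phi> ` disc \<subseteq> disc"
  shows
   "(bounded_B1_Zalpha \<alpha> (T_op u v \<phi>)
     \<longleftrightarrow>
     ((\<forall>j\<in>{1..4}. \<exists>M. \<forall>a\<in>disc. in_Zalpha \<alpha> (T_op u v \<phi> (test_fun j a)) \<and>
                         Zalpha_norm \<alpha> (T_op u v \<phi> (test_fun j a)) \<le> M)
      \<and> (\<exists>M. \<forall>z\<in>disc. (1 - (cmod z)\<^sup>2) powr \<alpha> *
            (cmod (deriv2 u z) +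
             cmod (2 * deriv u z * deriv \<phi> z + u z * deriv2 \<phi> z + deriv2 v z)) \<le> M)
      \<and> (\<exists>M. \<forall>z\<in>disc. (1 - (cmod z)\<^sup>2) powr \<alpha> *
            (cmod (u z * (deriv \<phi> z)\<^sup>2 + 2 * deriv v z * deriv \<phi> z + v z * deriv2 \<phi> z) +
             cmod (v z * (deriv \<phi> z)\<^sup>2)) \<le> M)))
   \<and>
   (bounded_B1_Zalpha \<alpha> (T_op u v \<phi>)
     \<longleftrightarrow>
     ((\<exists>M. \<forall>z\<in>disc. (1 - (cmod z)\<^sup>2) powr \<alpha> *
            (cmod (deriv2 u z) +
             cmod (2 * deriv u z * deriv \<phi> z + u z * deriv2 \<phi> z + deriv2 v z)
               / (1 - (cmod (\<phi> z))\<^sup>2)) \<le> M)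
      \<and> (\<exists>M. \<forall>z\<in>disc. (1 - (cmod z)\<^sup>2) powr \<alpha> *
            (cmod (u z * (deriv \<phi> z)\<^sup>2 + 2 * deriv v z * deriv \<phi> z + v z * deriv2 \<phi> z)
               / (1 - (cmod (\<phi> z))\<^sup>2)\<^sup>2 +
             cmod (v z * (deriv \<phi> z)\<^sup>2) / (1 - (cmod (\<phi> z))\<^sup>2) ^ 3) \<le> M)))"
  (is "(?i \<longleftrightarrow> (?test \<and> ?ii1 \<and> ?ii2)) \<and> (?i \<longleftrightarrow> (?iii1 \<and> ?iii2))")
proof -
  note hyps = assms(2-5)
  \<comment> \<open>Positivity of the denominator turns moduli of complex quotients into the real
    quotients of (iii).\<close>
  have norm_div: "cmod (x / of_real (1 - (cmod (\<phi> z))\<^sup>2) ^ n) = cmod x / (1 - (cmod (\<phi> z))\<^sup>2) ^ n"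
    if "z \<in> disc" for x z n
  proof -
    have "0 < 1 - (cmod (\<phi> z))\<^sup>2" proof -
      have "\<phi> z \<in> disc" using that assms(5) by blast
      then show ?thesis by (simp add: abs_square_less_1)
    qed
    then show ?thesis unfolding norm_divide norm_power norm_of_real by simp
  qed
  \<comment> \<open>The implications are proved in a cycle, (i) to (ii) to (iii) to (i), which
    yields both equivalences.\<close>
  have "?test \<and> ?ii1 \<and> ?ii2" if i: ?i
  proof -
    obtain C where C: "\<And>f. in_B1 f \<Longrightarrow> in_Zalpha \<alpha> (T_op u v \<phi> f) \<and> Zalpha_norm \<alpha> (T_op u v \<phi> f) \<le> C * B1_norm f"
      using i unfolding bounded_B1_Zalpha_def by blast
    \<comment> \<open>Boundedness provides \<open>C\<close> without a sign, hence the absolute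
      value. The 10000 is the uniform norm bound for the test functions.\<close>
    have "in_Zalpha \<alpha> (T_op u v \<phi> (test_fun j a)) \<and> Zalpha_norm \<alpha> (T_op u v \<phi> (test_fun j a)) \<le> \<bar>C\<bar> * 10000"
      if "j \<in> {1..4}" "a \<in> disc" for j a
    proof -
      have "C * B1_norm (test_fun j a) \<le> \<bar>C\<bar> * 10000"
        using test_fun_B1[OF that(2,1)] B1_norm_nonneg by (intro mult_mono) auto
      then show ?thesis using C[OF test_fun_B1(1)[OF that(2,1)]] by auto
    qed
    then have ?test by blast
    moreover have ?ii1 ?ii2
      unfolding weighted_bounded_pair using weighted_bounded_coefficients[OF hyps i] by auto
    ultimately show ?thesis by blast
  qed
  moreover have "?iii1 \<and> ?iii2" if ii: "?test \<and> ?ii1 \<and> ?ii2"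
  proof -
    have t: ?test
      and A: "weighted_bounded \<alpha> (deriv2 u)"
      and B: "weighted_bounded \<alpha> (\<lambda>z. 2 * deriv u z * deriv \<phi> z + u z * deriv2 \<phi> z + deriv2 v z)"
      and C: "weighted_bounded \<alpha> (\<lambda>z. u z * (deriv \<phi> z)\<^sup>2 + 2 * deriv v z * deriv \<phi> z + v z * deriv2 \<phi> z)"
      and D: "weighted_bounded \<alpha> (\<lambda>z. v z * (deriv \<phi> z)\<^sup>2)"
      using ii unfolding weighted_bounded_pair by auto
    note nec = weighted_bounded_necessary[OF hyps t A B C D]
    from conjI[OF A nec(1)] have ?iii1
      unfolding weighted_bounded_pair[symmetric] by (simp only: norm_div cong: ball_cong) (simp only: power_one_right)
    moreover from conjI[OF nec(2,3)] have ?iii2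
      unfolding weighted_bounded_pair[symmetric] by (simp only: norm_div cong: ball_cong)
    ultimately show ?thesis ..
  qed
  moreover have ?i if "?iii1 \<and> ?iii2"
    using that bounded_T_op[OF hyps] by blast
  ultimately show ?thesis by blast
qed

end
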